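(* Fix $1\le m\le\infty$ and let $\mathbf J^{(m)}=[J^{(m)}_{n,k}(\boldsymbol\beta)]_{n,k\ge0}$ be the $m$-Jacobi--Rogers triangle with production matrix $P^{(m)}(\boldsymbol\beta)$. Let $a,b,u,v,\lambda,\widehat a_i,\widehat b_i,\widehat c_i$ ($i\ge1$) be indeterminates and $\mathbf x$ a set of indeterminates. Assume that $P^{(m)}(\boldsymbol\beta)$ equals a finite product, in some order, of $\mathbf J(a,b,u,v,\lambda)$ and matrices each of the form $\mathbf L(\widehat a_i,\widehat b_i,\widehat c_i)$ or $\boldsymbol\Gamma^{(\Lambda,f_i(t))}$ ($i\ge1$), where each $f_i(t)$ is an $\mathbf x$-Pólya frequency function. Then: (i) the row-generating polynomial sequence $(\mathbf J_n(q))_{n\ge0}$, $\mathbf J_n(q)=\sum_kJ^{(m)}_{n,k}(\boldsymbol\beta)q^k$, is $3$-$(a,b,u,v,\lambda,\widehat{\mathbf a},\widehat{\mathbf b},\widehat{\mathbf c},\mathbf x,q)$-log-convex; (ii) for all nonnegative real values of $a,b,u,v,\lambda,\widehat{\mathbf a},\widehat{\mathbf b},\widehat{\mathbf c},\mathbf x$, the convolution $z_n=\sum_{k=0}^nJ^{(m)}_{n,k}(\boldsymbol\beta)s_kt_{n-k}$ preserves the Stieltjes moment property (if $(s_n)$ and $(t_n)$ are Stieltjes moment sequences, so is $(z_n)$).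
   Context: Partial $m$-Łukasiewicz paths: paths in $\mathbb Z\times\mathbb N$ starting on the horizontal axis with steps $(1,s)$, $-m\le s\le1$. $J^{(m)}_{n,k}(\boldsymbol\beta)$ is the generating polynomial of such paths from $(0,0)$ to $(n,k)$, where a rise at height $i$ has weight $\beta^{(-1)}_i$ if $m=1$ and $1$ if $m>1$, a level step at height $i$ has weight $\beta^{(0)}_i$, and an $\ell$-fall from height $i$ has weight $\beta^{(\ell)}_i$. $P^{(m)}(\boldsymbol\beta)$ has $(i,i+1)$ entry $\beta^{(-1)}_i$ ($m=1$) or $1$ ($m>1$), $(i,j)$ entry $\beta^{(i-j)}_i$ for $i-m\le j\le i$, zero otherwise. $\mathbf L(a,b,c)$: lower bidiagonal, diagonal $ka+b$, subdiagonal $(k,k-1)$ entry $kc$. $\mathbf J(a,b,u,v,\lambda)$: tridiagonal with $(n,n+1)$ entry $un+u+v$, $(n,n)$ entry $(2\lambda u+a)n+b+\lambda(u+v)$, $(n,n-1)$ entry $\lambda(a+\lambda u)n$. $\boldsymbol\Gamma^{(\Lambda,f)}=[\frac{i!}{j!}f_{i-j}]_{i,j}$ for $f=\sum f_nt^n$. $f$ is an $\mathbf x$-Pólya frequency function if its Toeplitz matrix $[f_{i-j}]$ has all minors polynomials in $\mathbf x$ with nonnegative coefficients. For polynomials $(a_n)$ in indeterminates $\mathbf z$: $\mathcal L[a_i]=a_{i-1}a_{i+1}-a_i^2$, $\mathcal L^k=\mathcal L(\mathcal L^{k-1})$; $3$-$\mathbf z$-log-convex means $\mathcal L^k[a_i]$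 has nonnegative coefficients for $k\le3$. A real sequence is Stieltjes moment if $a_n=\int_0^\infty x^nd\mu(x)$ for a nonnegative measure $\mu$. *)

theory Defs
  imports
    "HOL-Analysis.Analysis"
    "HOL-Library.Poly_Mapping"
    "HOL-Library.Extended_Nat"
    "HOL-Computational_Algebra.Polynomial"
    "HOL-Computational_Algebra.Formal_Power_Series"
    "Jordan_Normal_Form.Determinant"
begin

section \<open>Multivariate polynomials with real coefficients\<close>

text \<open>
  A monomial is a finitely supported exponent vector; the ring structure on polynomials is
  the convolution product of the library.
\<close>

type_synonym 'v mpoly = "('v \<Rightarrow>\<^sub>0 nat) \<Rightarrow>\<^sub>0 real"

definition mvar :: "'v \<Rightarrow> 'v mpoly" where
  "mvar v = Poly_Mapping.single (Poly_Mapping.single v 1) 1"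

definition mconst :: "real \<Rightarrow> 'v mpoly" where
  "mconst c = Poly_Mapping.single 0 c"

definition mcoeff_nonneg :: "'v mpoly \<Rightarrow> bool" where
  "mcoeff_nonneg p \<longleftrightarrow> (\<forall>e. 0 \<le> Poly_Mapping.lookup p e)"

definition mpoly_in :: "'v set \<Rightarrow> 'v mpoly \<Rightarrow> bool" where
  "mpoly_in S p \<longleftrightarrow> (\<forall>e \<in> Poly_Mapping.keys p. Poly_Mapping.keys e \<subseteq> S)"

definition meval :: "('v \<Rightarrow> real) \<Rightarrow> 'v mpoly \<Rightarrow> real" where
  "meval \<rho> p = (\<Sum>e \<in> Poly_Mapping.keys p.
     Poly_Mapping.lookup p e * (\<Prod>v \<in> Poly_Mapping.keys e. \<rho> v ^ Poly_Mapping.lookup e v))"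

text \<open>
  The indeterminates \<open>a, b, u, v, \<lambda>\<close> and \<open>a_i, b_i, c_i\<close> (with hats).  The polynomial ring
  in these and in the set \<open>\<^bold>x\<close> of further indeterminates is \<open>(param + 'x) mpoly\<close>.
\<close>

datatype param = Pa | Pb | Pu | Pv | Plam | Pahat nat | Pbhat nat | Pchat nat

definition xvars :: "(param + 'x) set" where
  "xvars = range Inr"

text \<open>
  Each parameter is either kept as an indeterminate or set to a nonnegative real number.
  Setting parameters to numbers is what makes an identity between \<open>Pmat m \<beta>\<close> and a product of
  the matrices below possible when \<open>m > 1\<close>, since then \<open>Pmat m \<beta>\<close> has superdiagonal \<open>1\<close>.
\<close>

definition parameter_values :: "(param \<Rightarrow> (param + 'x) mpoly) \<Rightarrow> bool" where
  "parameter_values \<theta> \<longleftrightarrow> (\<forall>p. \<theta> p = mvar (Inl p) \<or> (\<exists>c\<ge>0. \<theta> p = mconst c))"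

section \<open>Partial \<open>m\<close>-Lukasiewicz paths\<close>

text \<open>
  A path from \<open>(0, 0)\<close> to \<open>(n, k)\<close> is given by the list of the heights of its \<open>n + 1\<close> vertices.
  The second condition on a step says that it goes down by at most \<open>m\<close>.
\<close>

definition luk_paths :: "enat \<Rightarrow> nat \<Rightarrow> nat \<Rightarrow> nat list set" where
  "luk_paths m n k = {h. length h = Suc n \<and> h ! 0 = 0 \<and> h ! n = k \<and>
     (\<forall>i<n. h ! Suc i \<le> h ! i + 1 \<and> enat (h ! i) \<le> enat (h ! Suc i) + m)}"

text \<open>\<open>\<beta> l i\<close> stands for \<open>\<beta>\<close> with upper index \<open>l\<close> (\<open>-1 \<le> l \<le> m\<close>) and lower index \<open>i\<close>.\<close>

definition rise_weight :: "enat \<Rightarrow> (int \<Rightarrow> nat \<Rightarrow> 'a::comm_ring_1) \<Rightarrow> nat \<Rightarrow> 'a" where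
  "rise_weight m \<beta> i = (if m = 1 then \<beta> (-1) i else 1)"

definition step_weight :: "enat \<Rightarrow> (int \<Rightarrow> nat \<Rightarrow> 'a::comm_ring_1) \<Rightarrow> nat \<Rightarrow> nat \<Rightarrow> 'a" where
  "step_weight m \<beta> i j = (if j = i + 1 then rise_weight m \<beta> i else \<beta> (int i - int j) i)"

definition jacobi_rogers :: "enat \<Rightarrow> (int \<Rightarrow> nat \<Rightarrow> 'a::comm_ring_1) \<Rightarrow> nat \<Rightarrow> nat \<Rightarrow> 'a" where
  "jacobi_rogers m \<beta> n k =
     (\<Sum>h \<in> luk_paths m n k. \<Prod>i<n. step_weight m \<beta> (h ! i) (h ! Suc i))"

definition jacobi_rogers_row ::
    "enat \<Rightarrow> (int \<Rightarrow> nat \<Rightarrow> 'a::comm_ring_1) \<Rightarrow> nat \<Rightarrow> 'a poly" where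
  "jacobi_rogers_row m \<beta> n = (\<Sum>k\<le>n. Polynomial.monom (jacobi_rogers m \<beta> n k) k)"

section \<open>Infinite matrices\<close>

type_synonym 'a imat = "nat \<Rightarrow> nat \<Rightarrow> 'a"

text \<open>All matrices below have at most one superdiagonal, so the sum is finite.\<close>

definition imat_mult :: "'a::comm_ring_1 imat \<Rightarrow> 'a imat \<Rightarrow> 'a imat" where
  "imat_mult A B = (\<lambda>i j. \<Sum>k | A i k \<noteq> 0. A i k * B k j)"

definition imat_one :: "'a::comm_ring_1 imat" where
  "imat_one = (\<lambda>i j. if i = j then 1 else 0)"

definition imat_prod :: "'a::comm_ring_1 imat list \<Rightarrow> 'a imat" where
  "imat_prod Ms = foldr imat_mult Ms imat_one"

definition Pmat :: "enat \<Rightarrow> (int \<Rightarrow> nat \<Rightarrow> 'a::comm_ring_1) \<Rightarrow> 'a imat" where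
  "Pmat m \<beta> = (\<lambda>i j.
     if j = i + 1 then rise_weight m \<beta> i
     else if j \<le> i \<and> enat i \<le> enat j + m then \<beta> (int i - int j) i
     else 0)"

definition Lmat :: "'a::comm_ring_1 \<Rightarrow> 'a \<Rightarrow> 'a \<Rightarrow> 'a imat" where
  "Lmat a b c = (\<lambda>k j.
     if j = k then of_nat k * a + b
     else if k = j + 1 then of_nat k * c
     else 0)"

definition Jmat :: "'a::comm_ring_1 \<Rightarrow> 'a \<Rightarrow> 'a \<Rightarrow> 'a \<Rightarrow> 'a \<Rightarrow> 'a imat" where
  "Jmat a b u v lam = (\<lambda>n j.
     if j = n + 1 then u * of_nat n + u + v
     else if j = n then (2 * lam * u + a) * of_nat n + b + lam * (u + v)
     else if n = j + 1 then lam * (a + lam * u) * of_nat n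
     else 0)"

definition Gmat :: "'v mpoly fps \<Rightarrow> 'v mpoly imat" where
  "Gmat f = (\<lambda>i j. if j \<le> i then mconst (fact i / fact j) * fps_nth f (i - j) else 0)"

section \<open>Polya frequency functions\<close>

definition toeplitz :: "'a::zero fps \<Rightarrow> 'a imat" where
  "toeplitz f = (\<lambda>i j. if j \<le> i then fps_nth f (i - j) else 0)"

definition imat_minor ::
    "'a::comm_ring_1 imat \<Rightarrow> nat \<Rightarrow> (nat \<Rightarrow> nat) \<Rightarrow> (nat \<Rightarrow> nat) \<Rightarrow> 'a" where
  "imat_minor A k r c = Determinant.det (Matrix.mat k k (\<lambda>(i, j). A (r i) (c j)))"

definition polya_frequency :: "'v set \<Rightarrow> 'v mpoly fps \<Rightarrow> bool" where
  "polya_frequency S f \<longleftrightarrow>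
     (\<forall>k r c. strict_mono_on {..<k} r \<longrightarrow> strict_mono_on {..<k} c \<longrightarrow>
        mpoly_in S (imat_minor (toeplitz f) k r c) \<and>
        mcoeff_nonneg (imat_minor (toeplitz f) k r c))"

section \<open>Log-convexity and Stieltjes moment sequences\<close>

definition Lop :: "(nat \<Rightarrow> 'a::comm_ring_1) \<Rightarrow> nat \<Rightarrow> 'a" where
  "Lop a i = a (i - 1) * a (i + 1) - (a i)\<^sup>2"

text \<open>
  The sequence lives in the polynomial ring in \<open>'v\<close> and one more indeterminate \<open>q\<close>, the
  variable of the outer type \<^typ>\<open>'a poly\<close>.  The \<open>k\<close>-fold iterate of \<^const>\<open>Lop\<close> is meaningful
  only at indices \<open>i \<ge> k\<close>, where it involves no entry of negative index.
\<close>

definition log_convex_order :: "nat \<Rightarrow> (nat \<Rightarrow> 'v mpoly poly) \<Rightarrow> bool" where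
  "log_convex_order r a \<longleftrightarrow>
     (\<forall>k\<le>r. \<forall>i\<ge>k. \<forall>d. mcoeff_nonneg (Polynomial.coeff ((Lop ^^ k) a i) d))"

definition stieltjes_moment :: "(nat \<Rightarrow> real) \<Rightarrow> bool" where
  "stieltjes_moment s \<longleftrightarrow>
     (\<exists>\<mu> :: real measure. sets \<mu> = sets borel \<and>
        (\<forall>n. set_integrable \<mu> {0..} (\<lambda>x. x ^ n) \<and>
             s n = set_lebesgue_integral \<mu> {0..} (\<lambda>x. x ^ n)))"

end

theory Submission
  imports Defs
    "HOL-Probability.Probability"
    "HOL-Computational_Algebra.Fundamental_Theorem_Algebra"
begin

text \<open>
  Let \<open>B\<close> be the matrix of the \<open>binom(n, k) q^(n-k)\<close>.  Conjugation by \<open>B\<close> sends \<open>L(a,b,c)\<close> to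
  \<open>L(a,b,c+qa)\<close>, sends \<open>J(a,b,u,v,\<lambda>)\<close> to \<open>J(a,b,u,v,\<lambda>+q)\<close> and fixes the matrices \<open>\<Gamma>\<close>, all of which are
  coefficientwise totally positive.  Hence \<open>Q = B^(-1) P B\<close> is totally positive by Cauchy--Binet.
  The row polynomials are the numbers \<open>(Q^n)_00\<close>, and their Hankel matrix factors into two matrices
  that are built row by row from \<open>Q\<close>, so it is totally positive as well.

  The first three iterates of \<open>Lop\<close> are polynomials with nonnegative coefficients in Hankel minors of
  order at most \<open>4\<close>.  For the convolution, total positivity makes the quadratic forms of
  \<open>y^n J_n(x/y)\<close> nonnegative for all \<open>x \<ge> 0\<close>, \<open>y > 0\<close>; integrating over \<open>x\<close> and \<open>y\<close> against the
  representing measures of \<open>s\<close> and \<open>t\<close> shows that both Hankel forms of \<open>z\<close> are positive semidefinite,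
  and Stieltjes' theorem applies.
\<close>

section \<open>Minors and the Cauchy--Binet formula\<close>

text \<open>The binomial matrix enters because its column 0 lists the powers of \<open>q\<close>: if
  \<open>J\<close> is the triangle, column 0 of \<open>J B\<close> lists the row polynomials, and
  \<open>J B\<close> is generated from its first row by \<open>B^(-1) P B\<close> just as
  \<open>J\<close> is by \<open>P\<close>. Since conjugation passes through products, the order of
  the factors is irrelevant and each can be treated alone.

  Two obstacles shape the development. Multiplication of infinite matrices is not associative in
  general, so products carry a bound on the number of superdiagonals, or are read as limits of
  truncated sums that become stationary. Moreover the two claims are about different notions of
  positivity: coefficientwise in a polynomial ring containing \<open>q\<close> for log-convexity,
  and in the reals, at every value \<open>q = x/y\<close>, for the convolution. Total positivity is
  therefore developed relative to an arbitrary subsemiring \<open>N\<close> of a commutative ring,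
  and the two cases become two instances.\<close>

lemma permutes_lessThan_less: "p permutes {0..<k} \<Longrightarrow> i < k \<Longrightarrow> p i < (k::nat)"
  using permutes_in_image[of p "{0..<k}" i] by simp

lemma imat_minor_leibniz:
  "imat_minor A k r c = (\<Sum>p | p permutes {0..<k}. signof p * (\<Prod>i = 0..<k. A (r i) (c (p i))))"
proof -
  have "(\<Prod>i = 0..<k. Matrix.mat k k (\<lambda>(i, j). A (r i) (c j)) $$ (i, p i))
      = (\<Prod>i = 0..<k. A (r i) (c (p i)))" if "p permutes {0..<k}" for p
    using that by (intro prod.cong) (auto simp: permutes_lessThan_less)
  then show ?thesis
    unfolding imat_minor_def by (subst det_def'[of _ k]) (auto intro!: sum.cong)
qed

lemma imat_minor_cong:
  assumes "\<And>i j. i < k \<Longrightarrow> j < k \<Longrightarrow> A (r i) (c j) = A' (r' i) (c' j)"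
  shows "imat_minor A k r c = imat_minor A' k r' c'"
  unfolding imat_minor_def using assms by (intro arg_cong[where f = Determinant.det] cong_mat) auto

lemma imat_minor_transpose:
  "imat_minor (\<lambda>i j. A j i) k r c = imat_minor A k c r"
  unfolding imat_minor_def
  by (subst det_transpose[of _ k, symmetric])
     (auto intro!: arg_cong[where f = Determinant.det] eq_matI)

lemma (in comm_ring_hom) imat_minor_hom:
  "imat_minor (\<lambda>i j. hom (A i j)) k r c = hom (imat_minor A k r c)"
  unfolding imat_minor_def hom_det[symmetric]
  by (intro arg_cong[where f = Determinant.det] eq_matI) auto

lemma imat_minor_expand_row:
  "imat_minor A (Suc k) r c =
     (\<Sum>j<Suc k. (-1) ^ j * A (r 0) (c j) *
        imat_minor A k (\<lambda>i. r (Suc i)) (\<lambda>i. c (if i < j then i else Suc i)))"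
proof -
  let ?M = "Matrix.mat (Suc k) (Suc k) (\<lambda>(i, j). A (r i) (c j))"
  have "Determinant.det ?M = (\<Sum>j<Suc k. ?M $$ (0, j) * cofactor ?M 0 j)"
    by (rule laplace_expansion_row) auto
  also have "\<dots> = (\<Sum>j<Suc k. (-1) ^ j * A (r 0) (c j) *
        imat_minor A k (\<lambda>i. r (Suc i)) (\<lambda>i. c (if i < j then i else Suc i)))"
  proof (rule sum.cong[OF refl])
    fix j assume "j \<in> {..<Suc k}"
    moreover have "mat_delete ?M 0 j =
        Matrix.mat k k (\<lambda>(i, i'). A (r (Suc i)) (c (if i' < j then i' else Suc i')))"
      by (rule eq_matI) (auto simp: mat_delete_def)
    ultimately show "?M $$ (0, j) * cofactor ?M 0 j = (-1) ^ j * A (r 0) (c j) *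
        imat_minor A k (\<lambda>i. r (Suc i)) (\<lambda>i. c (if i < j then i else Suc i))"
      by (simp add: cofactor_def imat_minor_def mult_ac)
  qed
  finally show ?thesis by (simp add: imat_minor_def)
qed

lemma imat_minor_0 [simp]: "imat_minor A 0 r c = 1"
  by (simp add: imat_minor_leibniz)

text \<open>Every Leibniz term uses each row and each column exactly once, so the weights factor
  out. This will absorb the factors \<open>i!/j!\<close> of \<open>Gmat\<close>.\<close>

lemma imat_minor_scale:
  "imat_minor (\<lambda>i j. x i * A i j * y j) k r c =
     (\<Prod>i<k. x (r i)) * (\<Prod>j<k. y (c j)) * imat_minor A k r c"
proof -
  have "(\<Prod>i = 0..<k. x (r i) * A (r i) (c (p i)) * y (c (p i))) =
      (\<Prod>i<k. x (r i)) * (\<Prod>j<k. y (c j)) * (\<Prod>i = 0..<k. A (r i) (c (p i)))"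
    if "p permutes {0..<k}" for p
    using prod.permute[OF that, of "\<lambda>j. y (c j)"]
    by (simp add: prod.distrib comp_def atLeast0LessThan)
  then show ?thesis
    unfolding imat_minor_leibniz sum_distrib_left
    by (intro sum.cong refl) (simp add: mult_ac)
qed

lemma imat_minor_permute_rows:
  assumes "p permutes {0..<k}"
  shows "imat_minor A k (\<lambda>i. r (p i)) c = signof p * imat_minor A k r c"
proof -
  have "imat_minor A k (\<lambda>i. r (p i)) c =
    Determinant.det (Matrix.mat k k (\<lambda>(i, j). Matrix.mat k k (\<lambda>(i, j). A (r i) (c j)) $$ (p i, j)))"
    unfolding imat_minor_def using assms
    by (intro arg_cong[where f = Determinant.det] cong_mat) (auto simp: permutes_lessThan_less)
  also have "\<dots> = signof p * imat_minor A k r c"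
    unfolding imat_minor_def by (rule det_permute_rows) (use assms in auto)
  finally show ?thesis .
qed

lemma imat_minor_repeated_row:
  assumes "\<not> inj_on r {..<k}"
  shows "imat_minor A k r c = 0"
proof -
  obtain i j where ij: "i < k" "j < k" "i \<noteq> j" "r i = r j"
    using assms unfolding inj_on_def by auto
  show ?thesis unfolding imat_minor_def
    by (rule det_identical_rows[OF _ ij(3,1,2)]) (use ij in \<open>auto intro!: eq_vecI\<close>)
qed

text \<open>Cauchy--Binet, before the injective maps are grouped by their image.\<close>

lemma imat_minor_mult:
  assumes "\<And>i j. i < k \<Longrightarrow> j < k \<Longrightarrow> C (r i) (c j) = (\<Sum>l<n. A (r i) l * B l (c j))"
  shows "imat_minor C k r c =
    (\<Sum>g \<in> {0..<k} \<rightarrow>\<^sub>E {..<n}. (\<Prod>i = 0..<k. A (r i) (g i)) * imat_minor B k g c)"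
proof -
  have "(\<Prod>i = 0..<k. C (r i) (c (p i))) =
      (\<Sum>g \<in> {0..<k} \<rightarrow>\<^sub>E {..<n}. (\<Prod>i = 0..<k. A (r i) (g i)) * (\<Prod>i = 0..<k. B (g i) (c (p i))))"
    if "p permutes {0..<k}" for p
  proof -
    have "(\<Prod>i = 0..<k. C (r i) (c (p i))) = (\<Prod>i = 0..<k. \<Sum>l<n. A (r i) l * B l (c (p i)))"
      using that by (intro prod.cong) (auto simp: assms permutes_lessThan_less)
    then show ?thesis by (simp add: prod_sum_PiE prod.distrib)
  qed
  then have "imat_minor C k r c = (\<Sum>p | p permutes {0..<k}. \<Sum>g \<in> {0..<k} \<rightarrow>\<^sub>E {..<n}.
      signof p * ((\<Prod>i = 0..<k. A (r i) (g i)) * (\<Prod>i = 0..<k. B (g i) (c (p i)))))"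
    unfolding imat_minor_leibniz by (simp add: sum_distrib_left)
  also have "\<dots> = (\<Sum>g \<in> {0..<k} \<rightarrow>\<^sub>E {..<n}. \<Sum>p | p permutes {0..<k}.
      signof p * ((\<Prod>i = 0..<k. A (r i) (g i)) * (\<Prod>i = 0..<k. B (g i) (c (p i)))))"
    by (rule sum.swap)
  finally show ?thesis
    by (simp add: imat_minor_leibniz sum_distrib_left mult_ac)
qed

lemma strict_mono_on_enum:
  fixes S :: "nat set"
  assumes "finite S" "card S = k"
  obtains e where "strict_mono_on {..<k} e" "bij_betw e {..<k} S"
proof
  let ?e = "\<lambda>i. sorted_list_of_set S ! i"
  show "strict_mono_on {..<k} ?e"
    using assms strict_sorted_list_of_set[of S]
    by (auto intro!: strict_mono_onI simp: sorted_wrt_iff_nth_less)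
  show "bij_betw ?e {..<k} S"
    by (rule bij_betw_nth) (use assms in auto)
qed

text \<open>A non-injective \<open>g\<close> repeats a row of \<open>B\<close> and contributes 0.
  The injective \<open>g\<close> with image \<open>S\<close> are the increasing enumeration of
  \<open>S\<close> composed with a permutation \<open>p\<close>; reordering the rows of
  \<open>B\<close> costs \<open>signof p\<close>, and the signed products of \<open>A\<close> add up
  to a minor of \<open>A\<close>.\<close>

lemma imat_minor_cauchy_binet:
  assumes "\<And>i j. i < k \<Longrightarrow> j < k \<Longrightarrow> C (r i) (c j) = (\<Sum>l<n. A (r i) l * B l (c j))"
  obtains E where "finite E" "\<And>e. e \<in> E \<Longrightarrow> strict_mono_on {..<k} e"
    "imat_minor C k r c = (\<Sum>e\<in>E. imat_minor A k r e * imat_minor B k e c)"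
proof -
  let ?P = "{0..<k} \<rightarrow>\<^sub>E {..<n}"
  let ?T = "\<lambda>g. (\<Prod>i = 0..<k. A (r i) (g i)) * imat_minor B k g c"
  let ?I = "{g \<in> ?P. inj_on g {0..<k}}"
  let ?S = "{S. S \<subseteq> {..<n} \<and> card S = k}"
  define e where "e S = (SOME e. strict_mono_on {..<k} e \<and> bij_betw e {..<k} S)" for S :: "nat set"
  have e: "strict_mono_on {..<k} (e S)" "bij_betw (e S) {..<k} S" if "S \<in> ?S" for S
  proof -
    have "finite S" "card S = k" using that finite_subset by auto
    then have "\<exists>e. strict_mono_on {..<k} e \<and> bij_betw e {..<k} S"
      by (metis strict_mono_on_enum)
    then have "strict_mono_on {..<k} (e S) \<and> bij_betw (e S) {..<k} S"
      unfolding e_def by (rule someI_ex)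
    then show "strict_mono_on {..<k} (e S)" "bij_betw (e S) {..<k} S" by auto
  qed
  have fin: "finite ?P" by (rule finite_PiE) auto
  have finI: "finite ?I" using fin by (rule rev_finite_subset) auto
  have finS: "finite ?S" by auto
  have "imat_minor C k r c = sum ?T ?P" by (rule imat_minor_mult) (rule assms)
  also have "\<dots> = sum ?T ?I"
    using fin by (intro sum.mono_neutral_right)
      (auto simp: atLeast0LessThan imat_minor_repeated_row)
  also have "\<dots> = (\<Sum>S\<in>?S. sum ?T {g \<in> ?I. g ` {0..<k} = S})"
    using finI finS
    by (intro sum.group[symmetric]) (auto simp: card_image PiE_iff image_subset_iff)
  also have "\<dots> = (\<Sum>S\<in>?S. imat_minor A k r (e S) * imat_minor B k (e S) c)"
  proof (rule sum.cong[OF refl])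
    fix S assume S: "S \<in> ?S"
    note eS = e[OF S]
    have inj: "inj_on (e S) {0..<k}" and img: "e S ` {0..<k} = S"
      using eS(2) by (auto simp: bij_betw_def atLeast0LessThan)
    have "sum ?T {g \<in> ?I. g ` {0..<k} = S} =
        (\<Sum>p | p permutes {0..<k}. ?T (restrict (\<lambda>i. e S (p i)) {0..<k}))"
    proof (rule sum.reindex_bij_betw[symmetric], rule bij_betwI')
      fix p q assume p: "p \<in> {p. p permutes {0..<k}}" and q: "q \<in> {p. p permutes {0..<k}}"
      show "(restrict (\<lambda>i. e S (p i)) {0..<k} = restrict (\<lambda>i. e S (q i)) {0..<k}) = (p = q)"
      proof
        assume eq: "restrict (\<lambda>i. e S (p i)) {0..<k} = restrict (\<lambda>i. e S (q i)) {0..<k}"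
        show "p = q"
        proof
          fix i
          show "p i = q i"
          proof (cases "i < k")
            case True
            then have "e S (p i) = e S (q i)" using fun_cong[OF eq, of i] by simp
            moreover have "p i \<in> {0..<k}" "q i \<in> {0..<k}"
              using p q True by (auto simp: permutes_lessThan_less)
            ultimately show ?thesis using inj by (auto dest: inj_onD)
          next
            case False
            then show ?thesis
              using p q permutes_not_in[of p "{0..<k}" i] permutes_not_in[of q "{0..<k}" i] by simp
          qed
        qed
      qed simp
    next
      fix p assume "p \<in> {p. p permutes {0..<k}}"
      then have p: "p permutes {0..<k}" by simp
      have "inj_on (\<lambda>i. e S (p i)) {0..<k}"
        using comp_inj_on[of p "{0..<k}" "e S"] permutes_inj_on[OF p] inj permutes_image[OF p]
        by (simp add: comp_def)
      moreover have im: "(\<lambda>i. e S (p i)) ` {0..<k} = S"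
        using permutes_image[OF p] img image_image[of "e S" p "{0..<k}"] by simp
      moreover have "(\<lambda>i. e S (p i)) ` {0..<k} \<subseteq> {..<n}" using S im by auto
      ultimately show "restrict (\<lambda>i. e S (p i)) {0..<k} \<in> {g \<in> ?I. g ` {0..<k} = S}"
        by (auto simp: inj_on_def)
    next
      fix g assume "g \<in> {g \<in> ?I. g ` {0..<k} = S}"
      then have g: "g \<in> ?P" "inj_on g {0..<k}" "g ` {0..<k} = S" by auto
      \<comment> \<open>\<open>p i\<close> is the rank of \<open>g i\<close> in \<open>S\<close>; it
        is the identity from \<open>k\<close> on, as \<open>permutes\<close> demands.\<close>
      define p where "p i = (if i < k then inv_into {0..<k} (e S) (g i) else i)" for i
      have eg: "e S (p i) = g i" if "i < k" for i
        using that g(3) img by (auto simp: p_def intro!: f_inv_into_f)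
      have "p ` {0..<k} \<subseteq> {0..<k}"
        using g(3) img inv_into_into[of _ "e S" "{0..<k}"] by (fastforce simp: p_def)
      moreover have "inj_on p {0..<k}"
      proof (rule inj_onI)
        fix i j assume ij: "i \<in> {0..<k}" "j \<in> {0..<k}" "p i = p j"
        then have "g i = g j" using eg[of i] eg[of j] by simp
        then show "i = j" using g(2) ij by (auto dest: inj_onD)
      qed
      ultimately have "bij_betw p {0..<k} {0..<k}"
        by (simp add: bij_betw_def endo_inj_surj)
      then have "p permutes {0..<k}"
        by (rule bij_imp_permutes) (auto simp: p_def)
      moreover have "g = restrict (\<lambda>i. e S (p i)) {0..<k}"
        using g(1) eg by (intro ext) (auto simp: PiE_iff extensional_def)
      ultimately show "\<exists>p\<in>{p. p permutes {0..<k}}. g = restrict (\<lambda>i. e S (p i)) {0..<k}"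
        by blast
    qed
    also have "\<dots> = (\<Sum>p | p permutes {0..<k}.
        signof p * (\<Prod>i = 0..<k. A (r i) (e S (p i))) * imat_minor B k (e S) c)"
    proof (rule sum.cong[OF refl])
      fix p assume "p \<in> {p. p permutes {0..<k}}"
      then have p: "p permutes {0..<k}" by simp
      have "imat_minor B k (restrict (\<lambda>i. e S (p i)) {0..<k}) c
          = imat_minor B k (\<lambda>i. e S (p i)) c"
        by (rule imat_minor_cong) auto
      then show "?T (restrict (\<lambda>i. e S (p i)) {0..<k}) =
          signof p * (\<Prod>i = 0..<k. A (r i) (e S (p i))) * imat_minor B k (e S) c"
        by (simp add: imat_minor_permute_rows[OF p])
    qed
    also have "\<dots> = imat_minor A k r (e S) * imat_minor B k (e S) c"
      by (simp add: imat_minor_leibniz[of A] sum_distrib_right)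
    finally show "sum ?T {g \<in> ?I. g ` {0..<k} = S} = imat_minor A k r (e S) * imat_minor B k (e S) c" .
  qed
  also have "\<dots> = (\<Sum>e\<in>e ` ?S. imat_minor A k r e * imat_minor B k e c)"
  proof -
    have "inj_on e ?S"
    proof (rule inj_onI)
      fix S T assume S: "S \<in> ?S" and T: "T \<in> ?S" and "e S = e T"
      then show "S = T" using e(2)[OF S] e(2)[OF T] by (simp add: bij_betw_def)
    qed
    then show ?thesis by (simp add: sum.reindex)
  qed
  finally have "imat_minor C k r c = (\<Sum>e\<in>e ` ?S. imat_minor A k r e * imat_minor B k e c)" .
  then show thesis by (rule that[rotated 2]) (use finS e(1) in \<open>auto simp del: finite_Collect_conjI\<close>)
qed

section \<open>Total positivity\<close>

text \<open>\<open>N\<close> plays the role of the nonnegative elements. Only closure under sums and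
  products is required, no order on the ring: Cauchy--Binet needs nothing else.\<close>

locale semiring_cone =
  fixes N :: "'a::comm_ring_1 set"
  assumes zero_mem: "0 \<in> N" and one_mem: "1 \<in> N"
    and add_mem: "x \<in> N \<Longrightarrow> y \<in> N \<Longrightarrow> x + y \<in> N"
    and mult_mem: "x \<in> N \<Longrightarrow> y \<in> N \<Longrightarrow> x * y \<in> N"
begin

lemma sum_mem: "(\<And>i. i \<in> I \<Longrightarrow> f i \<in> N) \<Longrightarrow> sum f I \<in> N"
  by (induction I rule: infinite_finite_induct) (auto intro: zero_mem add_mem)

lemma prod_mem: "(\<And>i. i \<in> I \<Longrightarrow> f i \<in> N) \<Longrightarrow> prod f I \<in> N"
  by (induction I rule: infinite_finite_induct) (auto intro: one_mem mult_mem)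

lemma of_nat_mem: "of_nat n \<in> N"
  by (induction n) (auto intro: zero_mem one_mem add_mem)

definition tot_pos :: "'a imat \<Rightarrow> bool" where
  "tot_pos A \<longleftrightarrow> (\<forall>k r c. strict_mono_on {..<k} r \<longrightarrow> strict_mono_on {..<k} c \<longrightarrow>
     imat_minor A k r c \<in> N)"

lemma tot_posD:
  "tot_pos A \<Longrightarrow> strict_mono_on {..<k} r \<Longrightarrow> strict_mono_on {..<k} c \<Longrightarrow> imat_minor A k r c \<in> N"
  by (auto simp: tot_pos_def)

lemma tot_pos_transpose: "tot_pos A \<Longrightarrow> tot_pos (\<lambda>i j. A j i)"
  unfolding tot_pos_def by (subst imat_minor_transpose) blast

lemma tot_pos_scale:
  assumes "tot_pos A" "\<And>i. x i \<in> N" "\<And>j. y j \<in> N"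
  shows "tot_pos (\<lambda>i j. x i * A i j * y j)"
  unfolding tot_pos_def imat_minor_scale
  using assms by (auto intro!: mult_mem prod_mem tot_posD)

text \<open>
  Consecutive rows are supported on intervals that share at most an endpoint, so in each minor
  only the identity permutation contributes.
\<close>

lemma tot_pos_staircase:
  assumes "\<And>i j. A i j \<in> N" and "mono s"
    and supp: "\<And>i j. A i j \<noteq> 0 \<Longrightarrow> s i \<le> j \<and> j \<le> s (Suc i)"
  shows "tot_pos A"
  unfolding tot_pos_def
proof (intro allI impI)
  fix k :: nat and r c :: "nat \<Rightarrow> nat"
  assume r: "strict_mono_on {..<k} r" and c: "strict_mono_on {..<k} c"
  have "(\<Prod>i = 0..<k. A (r i) (c (p i))) = 0" if p: "p permutes {0..<k}" and "p \<noteq> id" for p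
  proof (rule ccontr)
    assume nz: "(\<Prod>i = 0..<k. A (r i) (c (p i))) \<noteq> 0"
    have ne: "A (r i) (c (p i)) \<noteq> 0" if "i < k" for i
    proof
      assume "A (r i) (c (p i)) = 0"
      then have "(\<Prod>i = 0..<k. A (r i) (c (p i))) = 0"
        using that by (intro prod_zero) auto
      then show False using nz by simp
    qed
    have pk: "p i < k" if "i < k" for i using permutes_lessThan_less[OF p that] .
    have mono: "p i < p j" if "i < j" "j < k" for i j
    proof -
      have "r i < r j" using strict_mono_onD[OF r, of i j] that by simp
      then have "s (Suc (r i)) \<le> s (r j)" using monoD[OF \<open>mono s\<close>, of "Suc (r i)" "r j"] by simp
      then have le: "c (p i) \<le> c (p j)"
        using supp[OF ne[of i]] supp[OF ne[of j]] that by auto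
      have "p i \<noteq> p j" using injD[OF permutes_inj[OF p], of i j] that by auto
      moreover have "\<not> p j < p i"
        using strict_mono_onD[OF c, of "p j" "p i"] pk[of i] pk[of j] that le by auto
      ultimately show ?thesis by simp
    qed
    have ge: "i \<le> p i" if "i < k" for i
      using that
    proof (induction i)
      case (Suc i)
      then show ?case using mono[of i "Suc i"] by simp
    qed simp
    have "p i = i" if "i < k" for i
      using that
    proof (induction "k - i" arbitrary: i rule: less_induct)
      case less
      have "p i \<le> i"
      proof (rule ccontr)
        assume "\<not> p i \<le> i"
        then have "p (p i) = p i" using less.hyps[of "p i"] less.prems pk by simp
        then have "p i = i" using injD[OF permutes_inj[OF p]] by blast
        then show False using \<open>\<not> p i \<le> i\<close> by simp
      qed
      then show ?case using ge[OF less.prems] by simp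
    qed
    then have "p = id" using permutes_not_in[OF p] by (intro ext) (metis atLeastLessThan_iff id_apply)
    then show False using \<open>p \<noteq> id\<close> by simp
  qed
  then have "imat_minor A k r c =
      (\<Sum>p\<in>{id}. signof p * (\<Prod>i = 0..<k. A (r i) (c (p i))))"
    unfolding imat_minor_leibniz
    by (intro sum.mono_neutral_right) (auto simp: permutes_id finite_permutations)
  then show "imat_minor A k r c \<in> N" by (simp add: prod_mem assms(1))
qed

text \<open>\<open>imat_mult\<close> sums over the support of a row of the left factor and returns 0
  if that is infinite. The truncated sums used here also cover products in which the right factor
  makes the sum finite, as for \<open>V\<close> in \<open>tot_pos_hankel\<close>.\<close>

definition is_product :: "'a imat \<Rightarrow> 'a imat \<Rightarrow> 'a imat \<Rightarrow> bool" where
  "is_product A B C \<longleftrightarrow>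
     (\<forall>i j. eventually (\<lambda>n. C i j = (\<Sum>l<n. A i l * B l j)) sequentially)"

text \<open>Rows of \<open>C\<close> and of \<open>A\<close> are indexed separately, and only the
  minors of \<open>A\<close> in the rows \<open>r'\<close> are assumed positive. In
  \<open>tot_pos_output\<close> that assumption is an induction hypothesis, with
  \<open>C = A\<close> and rows lowered by one.\<close>

lemma minor_product_mem:
  assumes C: "\<And>i j. i < k \<Longrightarrow> j < k \<Longrightarrow>
      eventually (\<lambda>n. C (r i) (c j) = (\<Sum>l<n. A (r' i) l * B l (c j))) sequentially"
    and A: "\<And>e. strict_mono_on {..<k} e \<Longrightarrow> imat_minor A k r' e \<in> N"
    and B: "tot_pos B" and c: "strict_mono_on {..<k} c"
  shows "imat_minor C k r c \<in> N"
proof -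
  \<comment> \<open>Finitely many entries are involved, so a single truncation point serves all of
    them.\<close>
  have "eventually (\<lambda>n. \<forall>i\<in>{..<k}. \<forall>j\<in>{..<k}. C (r i) (c j) = (\<Sum>l<n. A (r' i) l * B l (c j)))
      sequentially"
    using C by (intro eventually_ball_finite ballI) auto
  then obtain n where n: "C (r i) (c j) = (\<Sum>l<n. A (r' i) l * B l (c j))" if "i < k" "j < k" for i j
    by (auto simp: eventually_sequentially)
  define C' where "C' i j = (\<Sum>l<n. A (r' i) l * B l (c j))" for i j
  define A' where "A' i = A (r' i)" for i
  have eq: "C' (id i) (id j) = (\<Sum>l<n. A' (id i) l * (\<lambda>l j. B l (c j)) l (id j))" if "i < k" "j < k" for i j
    by (simp add: C'_def A'_def)
  obtain E where E: "finite E" "\<And>e. e \<in> E \<Longrightarrow> strict_mono_on {..<k} e"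
    and sum: "imat_minor C' k id id =
      (\<Sum>e\<in>E. imat_minor A' k id e * imat_minor (\<lambda>l j. B l (c j)) k e id)"
    by (rule imat_minor_cauchy_binet[where k = k and C = C' and r = id and c = id and n = n and A = A'
        and B = "\<lambda>l j. B l (c j)"]) (use eq in auto)
  have "imat_minor C k r c = imat_minor C' k id id"
    by (rule imat_minor_cong) (simp add: C'_def n)
  moreover have "imat_minor A' k id e = imat_minor A k r' e" for e
    by (rule imat_minor_cong) (simp add: A'_def)
  moreover have "imat_minor (\<lambda>l j. B l (c j)) k e id = imat_minor B k e c" for e
    by (rule imat_minor_cong) simp
  ultimately show ?thesis
    unfolding sum using E(2) by (auto intro!: sum_mem mult_mem A tot_posD[OF B] c simp: sum)
qed

lemma tot_pos_product:
  assumes "is_product A B C" "tot_pos A" "tot_pos B"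
  shows "tot_pos C"
  unfolding tot_pos_def
proof (intro allI impI)
  fix k :: nat and r c :: "nat \<Rightarrow> nat"
  assume "strict_mono_on {..<k} r" "strict_mono_on {..<k} c"
  then show "imat_minor C k r c \<in> N"
    using assms by (intro minor_product_mem[of k C r c A r B]) (auto simp: is_product_def tot_posD)
qed

text \<open>Row \<open>i + 1\<close> of \<open>W\<close> is row \<open>i\<close> times
  \<open>P\<close>. A minor that avoids row 0 is therefore, by Cauchy--Binet, a combination of
  minors of \<open>W\<close> with all rows lowered by one. A minor containing row 0, the unit vector
  at column 0, is 0 or loses its first row and column.\<close>

lemma tot_pos_output:
  assumes P: "tot_pos P" and W0: "\<And>j. W 0 j = (if j = 0 then 1 else 0)"
    and WS: "is_product W P (\<lambda>i. W (Suc i))"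
  shows "tot_pos W"
proof -
  have "imat_minor W k r c \<in> N"
    if "strict_mono_on {..<k} r" "strict_mono_on {..<k} c" for k r c
    using that
  \<comment> \<open>The \<open>Suc\<close> makes the measure drop even when the deleted row has
    index 0.\<close>
  proof (induction "\<Sum>i<k. Suc (r i)" arbitrary: k r c rule: less_induct)
    case less
    note r = less.prems(1) and c = less.prems(2)
    show ?case
    proof (cases k)
      case 0
      then show ?thesis by (simp add: one_mem)
    next
      case (Suc k')
      show ?thesis
      proof (cases "r 0 = 0")
        case True
        have c0: "c j \<noteq> 0" if "0 < j" "j < k" for j
          using strict_mono_onD[OF c, of 0 j] that by auto
        have "imat_minor W k r c = W 0 (c 0) * imat_minor W k' (\<lambda>i. r (Suc i)) (\<lambda>i. c (Suc i))"
          unfolding Suc imat_minor_expand_row lessThan_Suc_eq_insert_0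
          using c0 True by (subst sum.insert) (force simp: Suc W0 intro!: sum.neutral)+
        moreover have "imat_minor W k' (\<lambda>i. r (Suc i)) (\<lambda>i. c (Suc i)) \<in> N"
        proof (rule less.hyps)
          have "(\<Sum>i<k. Suc (r i)) = Suc (r 0) + (\<Sum>i<k'. Suc (r (Suc i)))"
            unfolding Suc sum.lessThan_Suc_shift by simp
          then show "(\<Sum>i<k'. Suc (r (Suc i))) < (\<Sum>i<k. Suc (r i))" by simp
          show "strict_mono_on {..<k'} (\<lambda>i. r (Suc i))" "strict_mono_on {..<k'} (\<lambda>i. c (Suc i))"
            using strict_mono_onD[OF r] strict_mono_onD[OF c] Suc by (auto intro!: strict_mono_onI)
        qed
        ultimately show ?thesis by (auto simp: W0 zero_mem)
      next
        case False
        have pos: "0 < r i" if "i < k" for i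
          using strict_mono_onD[OF r, of 0 i] that False Suc by (cases "i = 0") auto
        show ?thesis
        proof (rule minor_product_mem[where r' = "\<lambda>i. r i - 1" and A = W and B = P])
          fix i j assume "i < k" "j < k"
          then show "eventually (\<lambda>n. W (r i) (c j) = (\<Sum>l<n. W (r i - 1) l * P l (c j))) sequentially"
            using WS[unfolded is_product_def, rule_format, of "r i - 1" "c j"] pos[of i] by simp
        next
          fix e :: "nat \<Rightarrow> nat" assume e: "strict_mono_on {..<k} e"
          show "imat_minor W k (\<lambda>i. r i - 1) e \<in> N"
          proof (rule less.hyps[OF _ _ e])
            show "(\<Sum>i<k. Suc (r i - 1)) < (\<Sum>i<k. Suc (r i))"
              using Suc pos by (intro sum_strict_mono) auto
            show "strict_mono_on {..<k} (\<lambda>i. r i - 1)"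
            proof (rule strict_mono_onI)
              fix i j assume "i \<in> {..<k}" "j \<in> {..<k}" "i < j"
              then show "r i - 1 < r j - 1"
                using strict_mono_onD[OF r, of i j] pos[of i] by auto
            qed
          qed
        qed (use P c in auto)
      qed
    qed
  qed
  then show ?thesis by (auto simp: tot_pos_def)
qed

text \<open>Here \<open>W n j\<close> is the entry \<open>(0, j)\<close> of \<open>Q^n\<close>, and
  \<open>V n k\<close> below is the entry \<open>(k, 0)\<close>. From
  \<open>Q^(n+m) = Q^n Q^m\<close> the Hankel matrix is \<open>W\<close> times the transpose of
  \<open>V\<close>. Both are generated row by row, \<open>W\<close> by \<open>Q\<close> and
  \<open>V\<close> by the transpose of \<open>Q\<close>.\<close>

lemma tot_pos_hankel:
  assumes Q: "tot_pos Q" and band: "\<And>i j. Suc i < j \<Longrightarrow> Q i j = 0"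
    and W0: "\<And>j. W 0 j = (if j = 0 then 1 else 0)"
    and WS: "\<And>n j. W (Suc n) j = (\<Sum>l\<le>n. W n l * Q l j)"
  shows "tot_pos (\<lambda>i j. W (i + j) 0)"
proof -
  have W_band: "W n j = 0" if "n < j" for n j
    using that by (cases n) (auto simp: W0 WS band intro!: sum.neutral)
  define V :: "'a imat" where
    "V = rec_nat (\<lambda>k. if k = 0 then 1 else 0) (\<lambda>_ v k. \<Sum>l\<le>Suc k. Q k l * v l)"
  have V0: "V 0 k = (if k = 0 then 1 else 0)" and VS: "V (Suc n) k = (\<Sum>l\<le>Suc k. Q k l * V n l)" for n k
    by (simp_all add: V_def)
  have VS': "V (Suc n) k = (\<Sum>l<m. Q k l * V n l)" if "Suc k < m" for n k m
    unfolding VS using that band by (intro sum.mono_neutral_left) auto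
  have WV: "W (n + m) 0 = (\<Sum>l\<le>n. W n l * V m l)" for n m
  proof (induction m arbitrary: n)
    case 0
    have "(\<Sum>l\<le>n. W n l * V 0 l) = (\<Sum>l\<in>{0}. W n l * V 0 l)"
      by (rule sum.mono_neutral_right) (auto simp: V0)
    then show ?case by (simp add: V0)
  next
    case (Suc m)
    have "W (n + Suc m) 0 = (\<Sum>l\<le>Suc n. W (Suc n) l * V m l)"
      using Suc[of "Suc n"] by simp
    also have "\<dots> = (\<Sum>l\<le>Suc n. \<Sum>i\<le>n. W n i * (Q i l * V m l))"
      by (simp add: WS sum_distrib_right mult.assoc)
    also have "\<dots> = (\<Sum>i\<le>n. \<Sum>l\<le>Suc n. W n i * (Q i l * V m l))"
      by (rule sum.swap)
    also have "\<dots> = (\<Sum>i\<le>n. W n i * V (Suc m) i)"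
    proof (rule sum.cong[OF refl])
      fix i assume "i \<in> {..n}"
      then have "V (Suc m) i = (\<Sum>l\<le>Suc n. Q i l * V m l)"
        unfolding VS using band by (intro sum.mono_neutral_left) auto
      then show "(\<Sum>l\<le>Suc n. W n i * (Q i l * V m l)) = W n i * V (Suc m) i"
        by (simp only: sum_distrib_left)
    qed
    finally show ?case .
  qed
  have "is_product W Q (\<lambda>i. W (Suc i))"
    unfolding is_product_def eventually_sequentially
  proof (intro allI exI impI)
    fix i j n assume "Suc i \<le> n"
    then show "W (Suc i) j = (\<Sum>l<n. W i l * Q l j)"
      unfolding WS using W_band by (intro sum.mono_neutral_left) auto
  qed
  then have W: "tot_pos W" using tot_pos_output[OF Q] W0 by blast
  have "is_product V (\<lambda>i j. Q j i) (\<lambda>i. V (Suc i))"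
    unfolding is_product_def eventually_sequentially
  proof (intro allI exI impI)
    fix i j n assume "Suc (Suc j) \<le> n"
    then show "V (Suc i) j = (\<Sum>l<n. V i l * Q j l)"
      using VS'[of j n i] by (simp add: mult.commute)
  qed
  then have V: "tot_pos V" using tot_pos_output[OF tot_pos_transpose[OF Q]] V0 by blast
  have "is_product W (\<lambda>i j. V j i) (\<lambda>i j. W (i + j) 0)"
    unfolding is_product_def eventually_sequentially
  proof (intro allI exI impI)
    fix i j n assume "Suc i \<le> n"
    then show "W (i + j) 0 = (\<Sum>l<n. W i l * V j l)"
      unfolding WV using W_band by (intro sum.mono_neutral_left) auto
  qed
  then show ?thesis using tot_pos_product[OF _ W tot_pos_transpose[OF V]] by blast
qed

end

section \<open>The factors and the binomial matrix\<close>

text \<open>Only the superdiagonals are bounded; below the diagonal the matrix is arbitrary. This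
  makes each row finite, as \<open>imat_mult\<close> requires of its left factor.\<close>

definition banded :: "nat \<Rightarrow> 'a::comm_ring_1 imat \<Rightarrow> bool" where
  "banded d A \<longleftrightarrow> (\<forall>i j. i + d < j \<longrightarrow> A i j = 0)"

lemma imat_mult_row:
  assumes "finite S" "\<And>l. l \<notin> S \<Longrightarrow> A i l = 0"
  shows "imat_mult A B i j = (\<Sum>l\<in>S. A i l * B l j)"
  unfolding imat_mult_def using assms by (intro sum.mono_neutral_left) auto

lemma imat_mult_banded:
  assumes "banded d A" "i + d \<le> n"
  shows "imat_mult A B i j = (\<Sum>l\<le>n. A i l * B l j)"
  using assms by (intro imat_mult_row) (auto simp: banded_def)

lemma imat_mult_col:
  assumes "banded d A" "finite S" "\<And>l. l \<notin> S \<Longrightarrow> B l j = 0"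
  shows "imat_mult A B i j = (\<Sum>l\<in>S. A i l * B l j)"
proof -
  have "imat_mult A B i j = (\<Sum>l\<in>{..i + d} \<union> S. A i l * B l j)"
    using assms by (intro imat_mult_row) (auto simp: banded_def)
  also have "\<dots> = (\<Sum>l\<in>S. A i l * B l j)"
    using assms by (intro sum.mono_neutral_right) auto
  finally show ?thesis .
qed

lemma banded_mult:
  assumes A: "banded d A" and B: "banded e B"
  shows "banded (d + e) (imat_mult A B)"
  unfolding banded_def
proof (intro allI impI)
  fix i j assume "i + (d + e) < j"
  then show "imat_mult A B i j = 0"
    unfolding imat_mult_banded[OF A order_refl]
    using B by (intro sum.neutral) (auto simp: banded_def)
qed

lemma imat_mult_assoc:
  assumes A: "banded d A" and B: "banded e B"
  shows "imat_mult (imat_mult A B) C = imat_mult A (imat_mult B C)"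
proof (intro ext)
  fix i j
  have "imat_mult (imat_mult A B) C i j = (\<Sum>l\<le>i + (d + e). imat_mult A B i l * C l j)"
    by (rule imat_mult_banded[OF banded_mult[OF A B] order_refl])
  also have "\<dots> = (\<Sum>l\<le>i + (d + e). \<Sum>m\<le>i + d. A i m * (B m l * C l j))"
    by (simp add: imat_mult_banded[OF A order_refl] sum_distrib_right mult.assoc)
  also have "\<dots> = (\<Sum>m\<le>i + d. \<Sum>l\<le>i + (d + e). A i m * (B m l * C l j))"
    by (rule sum.swap)
  also have "\<dots> = (\<Sum>m\<le>i + d. A i m * imat_mult B C m j)"
  proof (rule sum.cong[OF refl])
    fix m assume "m \<in> {..i + d}"
    then have "imat_mult B C m j = (\<Sum>l\<le>i + (d + e). B m l * C l j)"
      by (intro imat_mult_banded[OF B]) auto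
    then show "(\<Sum>l\<le>i + (d + e). A i m * (B m l * C l j)) = A i m * imat_mult B C m j"
      by (simp only: sum_distrib_left)
  qed
  also have "\<dots> = imat_mult A (imat_mult B C) i j"
    by (rule imat_mult_banded[OF A order_refl, symmetric])
  finally show "imat_mult (imat_mult A B) C i j = imat_mult A (imat_mult B C) i j" .
qed

lemma imat_mult_add_left:
  assumes "banded d A" "banded e A'"
  shows "imat_mult (\<lambda>i j. A i j + A' i j) B = (\<lambda>i j. imat_mult A B i j + imat_mult A' B i j)"
proof (intro ext)
  fix i j
  have "banded (max d e) (\<lambda>i j. A i j + A' i j)" using assms by (auto simp: banded_def)
  from imat_mult_banded[OF this, of i "i + d + e"] show "imat_mult (\<lambda>i j. A i j + A' i j) B i j =
      imat_mult A B i j + imat_mult A' B i j"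
    using imat_mult_banded[OF assms(1), of i "i + d + e"] imat_mult_banded[OF assms(2), of i "i + d + e"]
    by (simp add: distrib_right sum.distrib)
qed

lemma imat_mult_add_right:
  "imat_mult A (\<lambda>i j. B i j + B' i j) = (\<lambda>i j. imat_mult A B i j + imat_mult A B' i j)"
  by (simp add: imat_mult_def fun_eq_iff distrib_left sum.distrib)

lemma banded_one: "banded 0 imat_one"
  by (auto simp: banded_def imat_one_def)

lemma imat_one_mult: "imat_mult imat_one A = A"
  by (intro ext, subst imat_mult_row[where S = "{_}"]) (auto simp: imat_one_def)

lemma imat_scalar_mult: "imat_mult (\<lambda>i j. b * imat_one i j) A = (\<lambda>i j. b * A i j)"
  by (intro ext, subst imat_mult_row[where S = "{_}"]) (auto simp: imat_one_def)

lemma imat_mult_scalar: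
  "banded d A \<Longrightarrow> imat_mult A (\<lambda>i j. b * imat_one i j) = (\<lambda>i j. b * A i j)"
  by (intro ext, subst imat_mult_col[where S = "{_}"]) (auto simp: imat_one_def)

lemma imat_mult_one: "banded d A \<Longrightarrow> imat_mult A imat_one = A"
  using imat_mult_scalar[of d A 1] by simp

section \<open>The Pascal matrix and its commutation relations\<close>

definition binomial_mat :: "'a::comm_ring_1 \<Rightarrow> 'a imat" where
  "binomial_mat q = (\<lambda>i j. of_nat (i choose j) * q ^ (i - j))"

lemma banded_binomial_mat: "banded 0 (binomial_mat q)"
  by (auto simp: banded_def binomial_mat_def binomial_eq_0)

definition Umat :: "'a::comm_ring_1 \<Rightarrow> 'a imat" where
  "Umat lam = (\<lambda>i j. if j = i then lam else if j = i + 1 then 1 else 0)"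

lemma banded_Lmat: "banded 0 (Lmat a b c)"
  by (auto simp: banded_def Lmat_def)

lemma banded_Umat: "banded 1 (Umat lam)"
  by (auto simp: banded_def Umat_def)

lemma banded_Jmat: "banded 1 (Jmat a b u v lam)"
  by (auto simp: banded_def Jmat_def)

text \<open>Let \<open>D = diag(0, 1, 2, ...)\<close> and let \<open>Lam\<close> have entries
  \<open>i\<close> at \<open>(i, i-1)\<close> and 0 elsewhere. Then
  \<open>L(a,b,c) = a D + b I + c Lam\<close> and \<open>B = exp(q Lam)\<close>. Since
  \<open>D Lam - Lam D = Lam\<close>, conjugation by \<open>B\<close> sends \<open>D\<close> to
  \<open>D + q Lam\<close>. The proof checks this entrywise.\<close>

lemma Lmat_binomial_mat:
  "imat_mult (Lmat a b c) (binomial_mat q) = imat_mult (binomial_mat q) (Lmat a b (c + q * a))"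
proof (intro ext)
  fix k j
  have "imat_mult (binomial_mat q) (Lmat a b (c + q * a)) k j =
      (\<Sum>l\<in>{j, Suc j}. binomial_mat q k l * Lmat a b (c + q * a) l j)"
    by (rule imat_mult_col[OF banded_binomial_mat]) (auto simp: Lmat_def)
  then have rhs: "imat_mult (binomial_mat q) (Lmat a b (c + q * a)) k j =
      of_nat (k choose j) * q ^ (k - j) * (of_nat j * a + b) +
      of_nat (k choose Suc j) * q ^ (k - Suc j) * (of_nat (Suc j) * (c + q * a))"
    by (simp add: Lmat_def binomial_mat_def)
  show "imat_mult (Lmat a b c) (binomial_mat q) k j =
      imat_mult (binomial_mat q) (Lmat a b (c + q * a)) k j"
  proof (cases k)
    case 0
    have "imat_mult (Lmat a b c) (binomial_mat q) k j =
        (\<Sum>l\<in>{0}. Lmat a b c k l * binomial_mat q l j)"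
      by (rule imat_mult_row) (auto simp: Lmat_def 0)
    then show ?thesis unfolding rhs using 0 by (cases j) (simp_all add: Lmat_def binomial_mat_def)
  next
    case (Suc k')
    have "imat_mult (Lmat a b c) (binomial_mat q) k j =
        (\<Sum>l\<in>{k', Suc k'}. Lmat a b c k l * binomial_mat q l j)"
      by (rule imat_mult_row) (auto simp: Lmat_def Suc)
    then have lhs: "imat_mult (Lmat a b c) (binomial_mat q) k j =
        of_nat k * c * (of_nat (k' choose j) * q ^ (k' - j)) +
        (of_nat k * a + b) * (of_nat (k choose j) * q ^ (k - j))"
      by (simp add: Lmat_def binomial_mat_def Suc)
    show ?thesis
    proof (cases "j < k")
      case False
      then have "k' choose j = 0" "k choose Suc j = 0" by (simp_all add: Suc binomial_eq_0)
      then show ?thesis unfolding lhs rhs using False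
        by (cases "j = k") (simp_all add: ac_simps binomial_eq_0)
    next
      case True
      then obtain t where t: "k = Suc (j + t)" using less_iff_Suc_add by blast
      then have k': "k' = j + t" using Suc by simp
      \<comment> \<open>The ring has no division, so the binomials are kept as atoms, related only
        by the absorption identities \<open>1\<close> and \<open>2\<close>, which are transported
        from the natural numbers.\<close>
      define X Y Z :: 'a where "X = of_nat (k choose j)" and "Y = of_nat (k choose Suc j)"
        and "Z = of_nat (k' choose j)"
      have "Suc k' * (k' choose j) = Suc j * (Suc k' choose Suc j)"
        using Suc_times_binomial_eq[of k' j] by (simp add: mult.commute)
      then have "of_nat (k * (k' choose j)) = (of_nat (Suc j * (k choose Suc j)) :: 'a)"
        unfolding Suc by (simp only:)
      then have 1: "of_nat k * Z = of_nat (Suc j) * Y" unfolding Z_def Y_def by (simp only: of_nat_mult)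
      have "Suc j * (k choose Suc j) = Suc t * (k choose j)"
        using binomial_absorb_comp[of k j] Suc_times_binomial_eq[of k' j] Suc t k'
        by (simp add: mult.commute del: binomial_Suc_Suc)
      then have "of_nat (Suc j * (k choose Suc j)) = (of_nat (Suc t * (k choose j)) :: 'a)" by (simp only:)
      then have 2: "of_nat (Suc j) * Y = of_nat (Suc t) * X" unfolding X_def Y_def by (simp only: of_nat_mult)
      have 3: "(of_nat k :: 'a) = of_nat j + of_nat (Suc t)" by (simp add: t)
      \<comment> \<open>Splitting \<open>k = j + (t + 1)\<close> in the diagonal entry separates the
        part that stays on the diagonal from the part that \<open>2\<close> turns into the extra
        subdiagonal term \<open>q * a\<close>.\<close>
      have "of_nat k * c * (Z * q ^ t) + (of_nat k * a + b) * (X * (q * q ^ t)) =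
          c * (of_nat k * Z) * q ^ t + (of_nat j * a + b) * (X * (q * q ^ t)) +
            a * (of_nat (Suc t) * X) * (q * q ^ t)"
        unfolding 3 by (simp only: algebra_simps)
      also have "\<dots> = c * (of_nat (Suc j) * Y) * q ^ t + (of_nat j * a + b) * (X * (q * q ^ t)) +
            a * (of_nat (Suc j) * Y) * (q * q ^ t)"
        by (simp only: 1 2)
      also have "\<dots> = X * (q * q ^ t) * (of_nat j * a + b) + Y * q ^ t * (of_nat (Suc j) * (c + q * a))"
        by (simp only: algebra_simps)
      finally show ?thesis unfolding lhs rhs X_def Y_def Z_def by (simp add: t k' Suc_diff_le)
    qed
  qed
qed

text \<open>\<open>Umat lam\<close> is \<open>lam I + S\<close> with the shift \<open>S\<close>. As
  \<open>S Lam - Lam S = I\<close>, conjugation by \<open>exp(q Lam)\<close> sends \<open>S\<close>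
  to \<open>S + q I\<close>. Entrywise this is Pascal's rule.\<close>

lemma Umat_binomial_mat:
  "imat_mult (Umat lam) (binomial_mat q) = imat_mult (binomial_mat q) (Umat (lam + q))"
proof (intro ext)
  fix n j
  have "imat_mult (Umat lam) (binomial_mat q) n j = (\<Sum>l\<in>{n, Suc n}. Umat lam n l * binomial_mat q l j)"
    by (rule imat_mult_row) (auto simp: Umat_def)
  then have lhs: "imat_mult (Umat lam) (binomial_mat q) n j =
      lam * binomial_mat q n j + binomial_mat q (Suc n) j"
    by (simp add: Umat_def)
  show "imat_mult (Umat lam) (binomial_mat q) n j = imat_mult (binomial_mat q) (Umat (lam + q)) n j"
  proof (cases j)
    case 0
    have "imat_mult (binomial_mat q) (Umat (lam + q)) n j =
        (\<Sum>l\<in>{0}. binomial_mat q n l * Umat (lam + q) l j)"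
      by (rule imat_mult_col[OF banded_binomial_mat]) (auto simp: Umat_def 0)
    then show ?thesis unfolding lhs by (simp add: 0 Umat_def binomial_mat_def algebra_simps)
  next
    case (Suc j')
    have "imat_mult (binomial_mat q) (Umat (lam + q)) n j =
        (\<Sum>l\<in>{j', Suc j'}. binomial_mat q n l * Umat (lam + q) l j)"
      by (rule imat_mult_col[OF banded_binomial_mat]) (auto simp: Umat_def Suc)
    then have rhs: "imat_mult (binomial_mat q) (Umat (lam + q)) n j =
        binomial_mat q n j' + binomial_mat q n j * (lam + q)"
      by (simp add: Umat_def Suc)
    \<comment> \<open>Subtraction is truncated, so the exponents match only for
      \<open>j \<le> n\<close>; for larger \<open>j\<close> the binomial coefficient
      vanishes.\<close>
    have "binomial_mat q n j * q = of_nat (n choose j) * q ^ (n - j')"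
    proof (cases "j \<le> n")
      case True
      then have "n - j' = Suc (n - j)" using Suc by simp
      then show ?thesis by (simp add: binomial_mat_def mult_ac)
    qed (simp add: binomial_mat_def binomial_eq_0)
    moreover have "binomial_mat q (Suc n) j =
        binomial_mat q n j' + of_nat (n choose j) * q ^ (n - j')"
      by (simp add: binomial_mat_def Suc algebra_simps)
    ultimately show ?thesis unfolding lhs rhs by (simp add: algebra_simps)
  qed
qed

lemma Jmat_decompose:
  "Jmat a b u v lam = (\<lambda>i j. imat_mult (Lmat u (u + v) (lam * u + a)) (Umat lam) i j + b * imat_one i j)"
proof (intro ext)
  fix i j
  show "Jmat a b u v lam i j =
      imat_mult (Lmat u (u + v) (lam * u + a)) (Umat lam) i j + b * imat_one i j"
  proof (cases i)
    case 0
    have "imat_mult (Lmat u (u + v) (lam * u + a)) (Umat lam) i j =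
        (\<Sum>l\<in>{0}. Lmat u (u + v) (lam * u + a) i l * Umat lam l j)"
      by (rule imat_mult_row) (auto simp: Lmat_def 0)
    then show ?thesis
      by (auto simp: 0 Lmat_def Umat_def Jmat_def imat_one_def algebra_simps)
  next
    case (Suc k)
    have "imat_mult (Lmat u (u + v) (lam * u + a)) (Umat lam) i j =
        (\<Sum>l\<in>{k, Suc k}. Lmat u (u + v) (lam * u + a) i l * Umat lam l j)"
      by (rule imat_mult_row) (auto simp: Lmat_def Suc)
    then show ?thesis
      by (auto simp: Suc Lmat_def Umat_def Jmat_def imat_one_def algebra_simps)
  qed
qed

text \<open>In \<open>L U + b I\<close> the conjugation raises the third argument of
  \<open>L\<close> by \<open>q * u\<close> and that of \<open>U\<close> by \<open>q\<close>; since
  \<open>lam * u + a + q * u = (lam + q) * u + a\<close>, both changes amount to replacing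
  \<open>lam\<close> by \<open>lam + q\<close>.\<close>

lemma Jmat_binomial_mat:
  "imat_mult (Jmat a b u v lam) (binomial_mat q) = imat_mult (binomial_mat q) (Jmat a b u v (lam + q))"
proof -
  let ?B = "binomial_mat q" and ?L = "Lmat u (u + v) (lam * u + a)"
    and ?L' = "Lmat u (u + v) ((lam + q) * u + a)"
  have L: "imat_mult ?L ?B = imat_mult ?B ?L'"
    by (simp add: Lmat_binomial_mat algebra_simps)
  have bI: "banded 0 (\<lambda>i j. b * imat_one i j)" by (auto simp: banded_def imat_one_def)
  have LU: "banded 1 (imat_mult ?L (Umat lam))"
    using banded_mult[OF banded_Lmat banded_Umat] by simp
  have "imat_mult (imat_mult ?L (Umat lam)) ?B = imat_mult ?L (imat_mult (Umat lam) ?B)"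
    by (rule imat_mult_assoc[OF banded_Lmat banded_Umat])
  also have "\<dots> = imat_mult ?L (imat_mult ?B (Umat (lam + q)))"
    by (simp only: Umat_binomial_mat)
  also have "\<dots> = imat_mult (imat_mult ?B ?L') (Umat (lam + q))"
    by (simp only: imat_mult_assoc[OF banded_Lmat banded_binomial_mat, symmetric] L)
  also have "\<dots> = imat_mult ?B (imat_mult ?L' (Umat (lam + q)))"
    by (rule imat_mult_assoc[OF banded_binomial_mat banded_Lmat])
  finally show ?thesis
    unfolding Jmat_decompose imat_mult_add_left[OF LU bI] imat_mult_add_right imat_scalar_mult
      imat_mult_scalar[OF banded_binomial_mat] by simp
qed

section \<open>Total positivity of the bidiagonal and tridiagonal factors\<close>

context semiring_cone
begin

lemma is_product_imat_mult:
  assumes "banded d A"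
  shows "is_product A B (imat_mult A B)"
  unfolding is_product_def eventually_sequentially
proof (intro allI exI impI)
  fix i j n assume "Suc (i + d) \<le> n"
  then show "imat_mult A B i j = (\<Sum>l<n. A i l * B l j)"
    using assms by (intro imat_mult_row) (auto simp: banded_def)
qed

lemma tot_pos_imat_mult: "banded d A \<Longrightarrow> tot_pos A \<Longrightarrow> tot_pos B \<Longrightarrow> tot_pos (imat_mult A B)"
  using is_product_imat_mult tot_pos_product by blast

lemma tot_pos_Lmat:
  assumes "a \<in> N" "b \<in> N" "c \<in> N"
  shows "tot_pos (Lmat a b c)"
\<comment> \<open>Row \<open>i\<close> lives on \<open>i - 1\<close> and \<open>i\<close>; truncated
  subtraction gives row 0 the interval consisting of 0 alone.\<close>
proof (rule tot_pos_staircase[where s = "\<lambda>i. i - 1"])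
  show "mono (\<lambda>i::nat. i - 1)" by (auto intro: monoI)
qed (use assms in \<open>auto simp: Lmat_def intro!: add_mem mult_mem of_nat_mem zero_mem one_mem split: if_splits\<close>)

lemma tot_pos_one: "tot_pos imat_one"
  by (rule tot_pos_staircase[where s = id])
    (auto simp: imat_one_def zero_mem one_mem mono_def split: if_splits)

text \<open>
  By \<open>Jmat_decompose\<close> the tridiagonal matrix is \<open>L U + b I\<close>, the product of the block row
  \<open>(L, b I)\<close> and the block column \<open>(U, I)\<close>.  Interleaving the columns of the two blocks turns both
  factors into staircase matrices.
\<close>

lemma tot_pos_Jmat:
  assumes "a \<in> N" "b \<in> N" "u \<in> N" "v \<in> N" "lam \<in> N"
  shows "tot_pos (Jmat a b u v lam)"
proof -
  \<comment> \<open>The even index \<open>2 * l\<close> stands for index \<open>l - 1\<close> of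
    \<open>L\<close> and \<open>U\<close>, so column 0 of \<open>X\<close> is padding and is
    zero.\<close>
  define X :: "'a imat" where "X = (\<lambda>n l. if l = 2 * n then (lam * u + a) * of_nat n
      else if l = 2 * n + 1 then b else if l = 2 * n + 2 then u * of_nat n + u + v else 0)"
  define Y :: "'a imat" where "Y = (\<lambda>l j. if l = 2 * j \<or> l = 2 * j + 1 then 1
      else if l = 2 * j + 2 then lam else 0)"
  have X: "tot_pos X"
  proof (rule tot_pos_staircase[where s = "\<lambda>i. 2 * i"])
    show "mono (\<lambda>i::nat. 2 * i)" by (auto intro: monoI)
  qed (use assms in \<open>auto simp: X_def intro!: add_mem mult_mem of_nat_mem zero_mem split: if_splits\<close>)
  have "tot_pos (\<lambda>j l. Y l j)"
  proof (rule tot_pos_staircase[where s = "\<lambda>i. 2 * i"])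
    show "mono (\<lambda>i::nat. 2 * i)" by (auto intro: monoI)
  qed (use assms in \<open>auto simp: Y_def intro!: one_mem zero_mem split: if_splits\<close>)
  from tot_pos_transpose[OF this] have Y: "tot_pos Y" by simp
  have "is_product X Y (Jmat a b u v lam)"
    unfolding is_product_def eventually_sequentially
  proof (intro allI exI impI)
    fix n j m :: nat assume m: "2 * n + 3 \<le> m"
    have "(\<Sum>l<m. X n l * Y l j) = (\<Sum>l\<in>{2 * n, 2 * n + 1, 2 * n + 2}. X n l * Y l j)"
      using m by (intro sum.mono_neutral_right) (auto simp: X_def)
    also have "\<dots> = (lam * u + a) * of_nat n * Y (2 * n) j + b * Y (2 * n + 1) j +
        (u * of_nat n + u + v) * Y (2 * n + 2) j"
      by (simp add: X_def)
    also have "\<dots> = Jmat a b u v lam n j"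
    proof -
      consider "j = n + 1" | "j = n" | "n = j + 1" | "j \<noteq> n + 1" "j \<noteq> n" "n \<noteq> j + 1" by blast
      then show ?thesis
      proof cases
        case 1 then show ?thesis by (simp add: Y_def Jmat_def)
      next
        case 2 then show ?thesis by (simp add: Y_def Jmat_def algebra_simps)
      next
        case 3 then show ?thesis by (simp add: Y_def Jmat_def algebra_simps)
      next
        case 4
        then have "2 * n \<noteq> 2 * j + 2" "2 * n + 2 \<noteq> 2 * j" "2 * n + 1 \<noteq> 2 * j + 2"
          "2 * n + 1 \<noteq> 2 * j" "2 * n \<noteq> 2 * j + 1" "2 * n + 2 \<noteq> 2 * j + 1"
          by presburger+
        then show ?thesis using 4 by (simp add: Y_def Jmat_def)
      qed
    qed
    finally show "Jmat a b u v lam n j = (\<Sum>l<m. X n l * Y l j)" by simp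
  qed
  then show ?thesis using tot_pos_product X Y by blast
qed

end

section \<open>Jacobi--Rogers triangles\<close>

lemma luk_paths_height:
  assumes "h \<in> luk_paths m n k" "i \<le> n"
  shows "h ! i \<le> i"
  using assms(2)
proof (induction i)
  case 0
  then show ?case using assms(1) by (simp add: luk_paths_def)
next
  case (Suc i)
  then have "h ! Suc i \<le> h ! i + 1" using assms(1) by (simp add: luk_paths_def)
  then show ?case using Suc by simp
qed

lemma finite_luk_paths: "finite (luk_paths m n k)"
proof (rule finite_subset)
  show "luk_paths m n k \<subseteq> {h. set h \<subseteq> {..n} \<and> length h = Suc n}"
  proof
    fix h assume h: "h \<in> luk_paths m n k"
    then have len: "length h = Suc n" by (simp add: luk_paths_def)
    have "set h \<subseteq> {..n}"
    proof
      fix x assume "x \<in> set h"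
      then obtain i where "i \<le> n" "x = h ! i" using len by (metis in_set_conv_nth less_Suc_eq_le)
      then show "x \<in> {..n}" using luk_paths_height[OF h, of i] by simp
    qed
    then show "h \<in> {h. set h \<subseteq> {..n} \<and> length h = Suc n}" using len by simp
  qed
  show "finite {h. set h \<subseteq> {..n} \<and> length h = Suc n}"
    by (rule finite_lists_length_eq) simp
qed

lemma jacobi_rogers_0: "jacobi_rogers m \<beta> 0 k = (if k = 0 then 1 else 0)"
proof -
  have "luk_paths m 0 k = (if k = 0 then {[0]} else {})"
    by (auto simp: luk_paths_def length_Suc_conv)
  then show ?thesis by (simp add: jacobi_rogers_def)
qed

text \<open>A path of length \<open>n + 1\<close> is a path of length \<open>n\<close> followed by
  one step; \<open>Pmat\<close> is therefore the production matrix of the triangle.\<close>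

lemma jacobi_rogers_Suc:
  "jacobi_rogers m \<beta> (Suc n) k = (\<Sum>j\<le>n. jacobi_rogers m \<beta> n j * Pmat m \<beta> j k)"
proof -
  \<comment> \<open>The heights from which a step to \<open>k\<close> is allowed. A rise satisfies
    the bound on falls trivially, so the two nonzero branches of \<open>Pmat\<close> together amount
    to membership in \<open>J\<close>.\<close>
  define J where "J = {j. j \<le> n \<and> k \<le> j + 1 \<and> enat j \<le> enat k + m}"
  define w where "w n h = (\<Prod>i<n. step_weight m \<beta> (h ! i) (h ! Suc i))" for n h
  have "finite J" by (rule finite_subset[of _ "{..n}"]) (auto simp: J_def)
  have P: "Pmat m \<beta> j k = (if j \<in> J then step_weight m \<beta> j k else 0)" if "j \<le> n" for j
  proof -
    have "enat j \<le> enat (Suc j) + m" by (rule order_trans[of _ "enat (Suc j)"]) auto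
    then show ?thesis using that by (auto simp: Pmat_def step_weight_def J_def)
  qed
  have "(\<Sum>j\<le>n. jacobi_rogers m \<beta> n j * Pmat m \<beta> j k) =
      (\<Sum>j\<in>J. jacobi_rogers m \<beta> n j * step_weight m \<beta> j k)"
    using P by (intro sum.mono_neutral_cong_right) (auto simp: J_def)
  also have "\<dots> = (\<Sum>(j, h)\<in>(SIGMA j:J. luk_paths m n j). w n h * step_weight m \<beta> j k)"
    using \<open>finite J\<close> finite_luk_paths
    by (simp add: jacobi_rogers_def w_def sum_distrib_right sum.Sigma)
  also have "\<dots> = (\<Sum>h\<in>luk_paths m (Suc n) k. w (Suc n) h)"
  proof (rule sum.reindex_bij_witness[where i = "\<lambda>h. (h ! n, butlast h)" and j = "\<lambda>(j, h). h @ [k]"])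
    fix h assume h: "h \<in> luk_paths m (Suc n) k"
    then have len: "length h = Suc (Suc n)" and last: "h ! Suc n = k" by (auto simp: luk_paths_def)
    then have "h \<noteq> []" by auto
    then have "last h = k" using last_conv_nth[of h] len last by simp
    then show "(case (h ! n, butlast h) of (j, h) \<Rightarrow> h @ [k]) = h" using append_butlast_last_id[OF \<open>h \<noteq> []\<close>] by simp
    show "(h ! n, butlast h) \<in> (SIGMA j:J. luk_paths m n j)"
      using h luk_paths_height[OF h, of n] by (auto simp: J_def luk_paths_def nth_butlast)
  next
    fix x assume "x \<in> (SIGMA j:J. luk_paths m n j)"
    then obtain j h where x: "x = (j, h)" "j \<in> J" "h \<in> luk_paths m n j" by auto
    then have len: "length h = Suc n" and hn: "h ! n = j" by (auto simp: luk_paths_def)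
    show "((case x of (j, h) \<Rightarrow> h @ [k]) ! n, butlast (case x of (j, h) \<Rightarrow> h @ [k])) = x"
      using x len hn by (simp add: nth_append)
    show "(case x of (j, h) \<Rightarrow> h @ [k]) \<in> luk_paths m (Suc n) k"
      using x len hn by (auto simp: luk_paths_def nth_append J_def less_Suc_eq)
    show "w (Suc n) (case x of (j, h) \<Rightarrow> h @ [k]) = (case x of (j, h) \<Rightarrow> w n h * step_weight m \<beta> j k)"
      using x len hn by (simp add: w_def nth_append)
  qed
  finally show ?thesis by (simp add: jacobi_rogers_def w_def)
qed

section \<open>Positive specializations of the coefficient ring\<close>

lemma mpoly_eq_sum_single:
  "p = (\<Sum>e\<in>Poly_Mapping.keys p. Poly_Mapping.single e (Poly_Mapping.lookup p e))"
proof (rule poly_mapping_eqI)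
  fix e
  have "(\<Sum>e'\<in>Poly_Mapping.keys p. Poly_Mapping.lookup (Poly_Mapping.single e' (Poly_Mapping.lookup p e')) e) =
      (\<Sum>e'\<in>Poly_Mapping.keys p. if e' = e then Poly_Mapping.lookup p e else 0)"
    by (intro sum.cong refl) (auto simp: lookup_single when_def)
  then show "Poly_Mapping.lookup p e =
      Poly_Mapping.lookup (\<Sum>e\<in>Poly_Mapping.keys p. Poly_Mapping.single e (Poly_Mapping.lookup p e)) e"
    by (simp add: lookup_sum in_keys_iff)
qed

lemma mcoeff_nonneg_zero: "mcoeff_nonneg 0"
  by (simp add: mcoeff_nonneg_def)

lemma mcoeff_nonneg_add: "mcoeff_nonneg p \<Longrightarrow> mcoeff_nonneg r \<Longrightarrow> mcoeff_nonneg (p + r)"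
  by (simp add: mcoeff_nonneg_def lookup_add)

lemma mcoeff_nonneg_sum: "(\<And>i. i \<in> I \<Longrightarrow> mcoeff_nonneg (f i)) \<Longrightarrow> mcoeff_nonneg (sum f I)"
  by (simp add: mcoeff_nonneg_def lookup_sum sum_nonneg)

lemma mcoeff_nonneg_single: "0 \<le> c \<Longrightarrow> mcoeff_nonneg (Poly_Mapping.single e c)"
  by (simp add: mcoeff_nonneg_def lookup_single when_def)

lemma mcoeff_nonneg_mult:
  assumes "mcoeff_nonneg p" "mcoeff_nonneg r"
  shows "mcoeff_nonneg (p * r)"
proof -
  have "mcoeff_nonneg ((\<Sum>e\<in>Poly_Mapping.keys p. Poly_Mapping.single e (Poly_Mapping.lookup p e)) *
      (\<Sum>e\<in>Poly_Mapping.keys r. Poly_Mapping.single e (Poly_Mapping.lookup r e)))"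
    unfolding sum_product mult_single using assms
    by (intro mcoeff_nonneg_sum mcoeff_nonneg_single) (simp add: mcoeff_nonneg_def)
  then show ?thesis by (simp flip: mpoly_eq_sum_single)
qed

lemma mcoeff_nonneg_mvar: "mcoeff_nonneg (mvar v)"
  by (simp add: mvar_def mcoeff_nonneg_single)

lemma mcoeff_nonneg_mconst: "0 \<le> c \<Longrightarrow> mcoeff_nonneg (mconst c)"
  by (simp add: mconst_def mcoeff_nonneg_single)

lemma mconst_mult: "mconst c * mconst d = mconst (c * d)"
  by (simp add: mconst_def mult_single)

lemma mconst_of_nat: "mconst (of_nat n) = of_nat n"
  unfolding mconst_def by (rule single_of_nat)

text \<open>Keeping the coefficients and taking the new variable for \<open>q\<close> gives
  coefficientwise positivity; evaluating at a nonnegative point with a nonnegative real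
  \<open>q\<close> gives the statement that the convolution needs.\<close>

locale positive_specialization = semiring_cone N + comm_ring_hom hom
  for N :: "'a::comm_ring_1 set" and hom :: "'v mpoly \<Rightarrow> 'a" +
  fixes q :: 'a
  assumes q_mem: "q \<in> N" and hom_mem: "mcoeff_nonneg p \<Longrightarrow> hom p \<in> N"
begin

abbreviation hom_mat :: "'v mpoly imat \<Rightarrow> 'a imat" where
  "hom_mat M \<equiv> (\<lambda>i j. hom (M i j))"

lemma hom_mat_mult:
  assumes "banded d A"
  shows "hom_mat (imat_mult A B) = imat_mult (hom_mat A) (hom_mat B)"
proof (intro ext)
  fix i j
  have "banded d (hom_mat A)" using assms by (auto simp: banded_def)
  then show "hom (imat_mult A B i j) = imat_mult (hom_mat A) (hom_mat B) i j"
    using assms by (simp add: imat_mult_banded[OF _ order_refl] hom_distribs)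
qed

text \<open>
  Conjugation by the binomial matrix makes \<open>M\<close> totally positive; the conjugation is stated without
  inverses so that no invertibility is needed.
\<close>

definition binomial_positive :: "nat \<Rightarrow> 'v mpoly imat \<Rightarrow> bool" where
  "binomial_positive d M \<longleftrightarrow> banded d M \<and> (\<exists>Q. banded d Q \<and> tot_pos Q \<and>
     imat_mult (hom_mat M) (binomial_mat q) = imat_mult (binomial_mat q) Q)"

lemma binomial_positive_mult:
  assumes "binomial_positive d A" "binomial_positive e B"
  shows "binomial_positive (d + e) (imat_mult A B)"
proof -
  let ?C = "binomial_mat q"
  obtain Q where A: "banded d A" and Q: "banded d Q" "tot_pos Q"
    and AQ: "imat_mult (hom_mat A) ?C = imat_mult ?C Q"
    using assms(1) by (auto simp: binomial_positive_def)
  obtain R where B: "banded e B" and R: "banded e R" "tot_pos R"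
    and BR: "imat_mult (hom_mat B) ?C = imat_mult ?C R"
    using assms(2) by (auto simp: binomial_positive_def)
  have A': "banded d (hom_mat A)" and B': "banded e (hom_mat B)"
    using A B by (auto simp: banded_def)
  have "imat_mult (hom_mat (imat_mult A B)) ?C = imat_mult (hom_mat A) (imat_mult (hom_mat B) ?C)"
    by (simp only: hom_mat_mult[OF A] imat_mult_assoc[OF A' B'])
  also have "\<dots> = imat_mult (imat_mult (hom_mat A) ?C) R"
    by (simp only: BR imat_mult_assoc[OF A' banded_binomial_mat])
  also have "\<dots> = imat_mult ?C (imat_mult Q R)"
    by (simp only: AQ imat_mult_assoc[OF banded_binomial_mat Q(1)])
  finally show ?thesis
    unfolding binomial_positive_def
    using banded_mult[OF A B] banded_mult[OF Q(1) R(1)] tot_pos_imat_mult[OF Q R(2)] by blast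
qed

lemma binomial_positive_one: "binomial_positive 0 imat_one"
proof -
  have "hom_mat imat_one = imat_one" by (auto simp: imat_one_def fun_eq_iff)
  then show ?thesis
    unfolding binomial_positive_def
    using banded_one tot_pos_one imat_one_mult imat_mult_one[OF banded_binomial_mat] by metis
qed

lemma binomial_positive_prod:
  "(\<And>M. M \<in> set Ms \<Longrightarrow> binomial_positive 0 M) \<Longrightarrow> binomial_positive 0 (imat_prod Ms)"
proof (induction Ms)
  case Nil
  then show ?case by (simp add: imat_prod_def binomial_positive_one)
next
  case (Cons M Ms)
  then show ?case using binomial_positive_mult[of 0 M 0 "imat_prod Ms"] by (simp add: imat_prod_def)
qed

text \<open>All factors other than \<open>J\<close> are lower triangular, so the product keeps the
  bandwidth of \<open>J\<close>. For the tridiagonal factor this is the single superdiagonal that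
  \<open>tot_pos_hankel\<close> requires.\<close>

lemma binomial_positive_prod_insert:
  assumes "\<And>M. M \<in> set Ms \<Longrightarrow> binomial_positive 0 M"
    and "binomial_positive d J" "binomial_positive 0 (imat_prod Ns)"
  shows "binomial_positive d (imat_prod (Ms @ [J] @ Ns))"
  using assms
proof (induction Ms)
  case Nil
  then show ?case using binomial_positive_mult[of d J 0 "imat_prod Ns"] by (simp add: imat_prod_def)
next
  case (Cons M Ms)
  then show ?case
    using binomial_positive_mult[of 0 M d "imat_prod (Ms @ [J] @ Ns)"] by (simp add: imat_prod_def)
qed

lemma binomial_positive_Lmat:
  assumes "mcoeff_nonneg a" "mcoeff_nonneg b" "mcoeff_nonneg c"
  shows "binomial_positive 0 (Lmat a b c)"
proof -
  have "hom_mat (Lmat a b c) = Lmat (hom a) (hom b) (hom c)"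
    by (auto simp: Lmat_def fun_eq_iff hom_distribs)
  then show ?thesis
    unfolding binomial_positive_def
    using Lmat_binomial_mat[of "hom a" "hom b" "hom c" q]
      tot_pos_Lmat[of "hom a" "hom b" "hom c + q * hom a"] assms
    by (auto intro!: exI[of _ "Lmat (hom a) (hom b) (hom c + q * hom a)"] banded_Lmat add_mem mult_mem q_mem hom_mem)
qed

lemma binomial_positive_Jmat:
  assumes "mcoeff_nonneg a" "mcoeff_nonneg b" "mcoeff_nonneg u" "mcoeff_nonneg v" "mcoeff_nonneg lam"
  shows "binomial_positive 1 (Jmat a b u v lam)"
proof -
  have "hom_mat (Jmat a b u v lam) = Jmat (hom a) (hom b) (hom u) (hom v) (hom lam)"
    by (auto simp: Jmat_def fun_eq_iff hom_distribs)
  then show ?thesis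
    unfolding binomial_positive_def
    using Jmat_binomial_mat[of "hom a" "hom b" "hom u" "hom v" "hom lam" q]
      tot_pos_Jmat[of "hom a" "hom b" "hom u" "hom v" "hom lam + q"] assms
    by (auto simp del: One_nat_def
        intro!: exI[of _ "Jmat (hom a) (hom b) (hom u) (hom v) (hom lam + q)"] banded_Jmat add_mem q_mem hom_mem)
qed

text \<open>With \<open>Lam\<close> the matrix having entries \<open>i\<close> at
  \<open>(i, i-1)\<close>, \<open>Gmat f\<close> is the power series \<open>f(Lam)\<close> and the
  binomial matrix is \<open>exp(q Lam)\<close>, so they commute.\<close>

lemma Gmat_binomial_mat:
  "imat_mult (hom_mat (Gmat f)) (binomial_mat q) = imat_mult (binomial_mat q) (hom_mat (Gmat f))"
proof (intro ext)
  fix i j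
  have band: "banded 0 (hom_mat (Gmat f))" by (auto simp: banded_def Gmat_def)
  \<comment> \<open>The target ring receives quotients of factorials only through
    \<open>hom\<close>; writing the integers as values of \<open>\<kappa>\<close> too lets all
    numerical factors be combined inside the reals.\<close>
  define \<kappa> where "\<kappa> x = hom (mconst x)" for x
  have \<kappa>_of_nat: "of_nat n = \<kappa> (of_nat n)" for n
    by (simp add: \<kappa>_def mconst_of_nat hom_distribs)
  have \<kappa>_mult: "\<kappa> x * \<kappa> y = \<kappa> (x * y)" for x y
    by (simp add: \<kappa>_def mconst_mult flip: hom_mult)
  show "imat_mult (hom_mat (Gmat f)) (binomial_mat q) i j =
      imat_mult (binomial_mat q) (hom_mat (Gmat f)) i j"
  proof (cases "j \<le> i")
    case True
    have "imat_mult (hom_mat (Gmat f)) (binomial_mat q) i j =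
        (\<Sum>l\<le>i. hom (Gmat f i l) * binomial_mat q l j)"
      by (rule imat_mult_banded[OF band]) simp
    also have "\<dots> = (\<Sum>l\<in>{j..i}. hom (Gmat f i l) * binomial_mat q l j)"
      by (intro sum.mono_neutral_right) (auto simp: binomial_mat_def binomial_eq_0)
    also have "\<dots> = (\<Sum>l\<in>{j..i}. \<kappa> (fact i / (fact j * fact (l - j))) * hom (fps_nth f (i - l)) * q ^ (l - j))"
    proof (rule sum.cong[OF refl])
      fix l assume l: "l \<in> {j..i}"
      have "hom (Gmat f i l) * binomial_mat q l j =
          \<kappa> (fact i / fact l) * \<kappa> (of_nat (l choose j)) * hom (fps_nth f (i - l)) * q ^ (l - j)"
        using l by (simp add: Gmat_def binomial_mat_def hom_distribs \<kappa>_of_nat mult_ac flip: \<kappa>_def)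
      also have "\<kappa> (fact i / fact l) * \<kappa> (of_nat (l choose j)) = \<kappa> (fact i / (fact j * fact (l - j)))"
        using l by (simp add: \<kappa>_mult binomial_fact)
      finally show "hom (Gmat f i l) * binomial_mat q l j =
          \<kappa> (fact i / (fact j * fact (l - j))) * hom (fps_nth f (i - l)) * q ^ (l - j)" .
    qed
    \<comment> \<open>The reflection \<open>l \<mapsto> i + j - l\<close> exchanges
      \<open>i - l\<close> and \<open>l - j\<close>, that is, the roles of the two factors.\<close>
    also have "\<dots> = (\<Sum>l\<in>{j..i}. \<kappa> (fact i / (fact j * fact (i - l))) * hom (fps_nth f (l - j)) * q ^ (i - l))"
      using True by (intro sum.reindex_bij_witness[where i = "\<lambda>l. i + j - l" and j = "\<lambda>l. i + j - l"]) auto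
    also have "\<dots> = (\<Sum>l\<in>{j..i}. binomial_mat q i l * hom (Gmat f l j))"
    proof (rule sum.cong[OF refl])
      fix l assume l: "l \<in> {j..i}"
      have "binomial_mat q i l * hom (Gmat f l j) =
          \<kappa> (of_nat (i choose l)) * \<kappa> (fact l / fact j) * hom (fps_nth f (l - j)) * q ^ (i - l)"
        using l by (simp add: Gmat_def binomial_mat_def hom_distribs \<kappa>_of_nat mult_ac flip: \<kappa>_def)
      also have "\<kappa> (of_nat (i choose l)) * \<kappa> (fact l / fact j) = \<kappa> (fact i / (fact j * fact (i - l)))"
        using l by (simp add: \<kappa>_mult binomial_fact mult_ac)
      finally show "\<kappa> (fact i / (fact j * fact (i - l))) * hom (fps_nth f (l - j)) * q ^ (i - l) =
          binomial_mat q i l * hom (Gmat f l j)" by simp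
    qed
    also have "\<dots> = (\<Sum>l\<le>i. binomial_mat q i l * hom (Gmat f l j))"
      by (intro sum.mono_neutral_left) (auto simp: Gmat_def)
    also have "\<dots> = imat_mult (binomial_mat q) (hom_mat (Gmat f)) i j"
      by (rule imat_mult_banded[OF banded_binomial_mat, symmetric]) simp
    finally show ?thesis .
  next
    case False
    then show ?thesis
      using banded_mult[OF band banded_binomial_mat] banded_mult[OF banded_binomial_mat band]
      by (simp add: banded_def)
  qed
qed

text \<open>The conjugate of \<open>Gmat f\<close> is \<open>Gmat f\<close> itself, a Toeplitz
  matrix with row \<open>i\<close> scaled by \<open>i!\<close> and column \<open>j\<close> by
  \<open>1/j!\<close>.\<close>

lemma binomial_positive_Gmat:
  assumes "polya_frequency S f"
  shows "binomial_positive 0 (Gmat f)"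
proof -
  have "tot_pos (hom_mat (toeplitz f))"
    unfolding tot_pos_def imat_minor_hom
    using assms by (auto simp: polya_frequency_def intro!: hom_mem)
  then have "tot_pos (\<lambda>i j. hom (mconst (fact i)) * hom_mat (toeplitz f) i j * hom (mconst (1 / fact j)))"
    by (rule tot_pos_scale) (auto intro!: hom_mem mcoeff_nonneg_mconst)
  also have "(\<lambda>i j. hom (mconst (fact i)) * hom_mat (toeplitz f) i j * hom (mconst (1 / fact j))) = hom_mat (Gmat f)"
  proof (intro ext)
    fix i j
    have "mconst (fact i / fact j) = (mconst (fact i) * mconst (1 / fact j) :: 'v mpoly)"
      by (simp add: mconst_mult)
    then show "hom (mconst (fact i)) * hom (toeplitz f i j) * hom (mconst (1 / fact j)) = hom (Gmat f i j)"
      by (simp add: toeplitz_def Gmat_def hom_distribs mult_ac)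
  qed
  finally have "tot_pos (hom_mat (Gmat f))" .
  moreover have "banded 0 (Gmat f)" "banded 0 (hom_mat (Gmat f))"
    by (auto simp: banded_def Gmat_def)
  ultimately show ?thesis
    unfolding binomial_positive_def using Gmat_binomial_mat by blast
qed

text \<open>For \<open>W = J C\<close>, with \<open>J\<close> the triangle and \<open>C\<close> the
  binomial matrix, row \<open>n + 1\<close> is \<open>J_n P C = J_n C Q\<close>, hence row
  \<open>n\<close> of \<open>W\<close> times \<open>Q\<close>. Column 0 of \<open>C\<close> consists
  of the powers of \<open>q\<close>, so \<open>W n 0\<close> is the row polynomial.\<close>

lemma jacobi_rogers_hankel:
  assumes "binomial_positive 1 (Pmat m \<beta>)"
  shows "tot_pos (\<lambda>i j. \<Sum>k\<le>i + j. hom (jacobi_rogers m \<beta> (i + j) k) * q ^ k)"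
proof -
  let ?C = "binomial_mat q" and ?P = "hom_mat (Pmat m \<beta>)"
  obtain Q where P: "banded 1 ?P" and Q: "banded 1 Q" "tot_pos Q"
    and PQ: "imat_mult ?P ?C = imat_mult ?C Q"
    using assms by (auto simp: binomial_positive_def banded_def)
  define W where "W n j = (\<Sum>k\<le>n. hom (jacobi_rogers m \<beta> n k) * ?C k j)" for n j
  have "tot_pos (\<lambda>i j. W (i + j) 0)"
  proof (rule tot_pos_hankel[OF Q(2)])
    show "Q i j = 0" if "Suc i < j" for i j using Q(1) that by (simp add: banded_def)
    show "W 0 j = (if j = 0 then 1 else 0)" for j
      by (cases j) (simp_all add: W_def jacobi_rogers_0 binomial_mat_def)
    fix n j
    have "W (Suc n) j = (\<Sum>k\<le>Suc n. \<Sum>i\<le>n. hom (jacobi_rogers m \<beta> n i) * (?P i k * ?C k j))"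
      by (simp add: W_def jacobi_rogers_Suc hom_distribs sum_distrib_right mult.assoc del: sum.atMost_Suc)
    also have "\<dots> = (\<Sum>i\<le>n. \<Sum>k\<le>Suc n. hom (jacobi_rogers m \<beta> n i) * (?P i k * ?C k j))"
      by (rule sum.swap)
    also have "\<dots> = (\<Sum>i\<le>n. hom (jacobi_rogers m \<beta> n i) * (\<Sum>l\<le>n. ?C i l * Q l j))"
    proof (rule sum.cong[OF refl])
      fix i assume "i \<in> {..n}"
      then have "(\<Sum>k\<le>Suc n. ?P i k * ?C k j) = (\<Sum>l\<le>n. ?C i l * Q l j)"
        using imat_mult_banded[OF P, of i "Suc n" ?C j] PQ
          imat_mult_banded[OF banded_binomial_mat, of i n q Q j] by simp
      then show "(\<Sum>k\<le>Suc n. hom (jacobi_rogers m \<beta> n i) * (?P i k * ?C k j)) =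
          hom (jacobi_rogers m \<beta> n i) * (\<Sum>l\<le>n. ?C i l * Q l j)"
        by (simp only: sum_distrib_left[symmetric])
    qed
    also have "\<dots> = (\<Sum>l\<le>n. W n l * Q l j)"
      unfolding W_def sum_distrib_left sum_distrib_right
      by (subst sum.swap) (simp add: mult.assoc)
    finally show "W (Suc n) j = (\<Sum>l\<le>n. W n l * Q l j)" .
  qed
  then show ?thesis by (simp add: W_def binomial_mat_def)
qed

end

section \<open>Hankel minors\<close>

lemma imat_minor_1: "imat_minor A (Suc 0) r c = A (r 0) (c 0)"
  by (simp add: imat_minor_expand_row)

lemma imat_minor_2: "imat_minor A (Suc (Suc 0)) r c =
    A (r 0) (c 0) * A (r 1) (c 1) - A (r 0) (c 1) * A (r 1) (c 0)"
  by (simp add: imat_minor_expand_row[of _ "Suc 0"] imat_minor_1)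

lemma imat_minor_3: "imat_minor A (Suc (Suc (Suc 0))) r c =
    A (r 0) (c 0) * (A (r 1) (c 1) * A (r 2) (c 2) - A (r 1) (c 2) * A (r 2) (c 1)) -
    A (r 0) (c 1) * (A (r 1) (c 0) * A (r 2) (c 2) - A (r 1) (c 2) * A (r 2) (c 0)) +
    A (r 0) (c 2) * (A (r 1) (c 0) * A (r 2) (c 1) - A (r 1) (c 1) * A (r 2) (c 0))"
  by (simp add: imat_minor_expand_row[of _ "Suc (Suc 0)"] imat_minor_2 numeral_eq_Suc)

lemma imat_minor_4: "imat_minor A (Suc (Suc (Suc (Suc 0)))) r c =
    A (r 0) (c 0) * imat_minor A (Suc (Suc (Suc 0))) (\<lambda>i. r (Suc i)) (\<lambda>i. c (Suc i)) -
    A (r 0) (c 1) * imat_minor A (Suc (Suc (Suc 0))) (\<lambda>i. r (Suc i)) (\<lambda>i. c (if i < 1 then i else Suc i)) +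
    A (r 0) (c 2) * imat_minor A (Suc (Suc (Suc 0))) (\<lambda>i. r (Suc i)) (\<lambda>i. c (if i < 2 then i else Suc i)) -
    A (r 0) (c 3) * imat_minor A (Suc (Suc (Suc 0))) (\<lambda>i. r (Suc i)) (\<lambda>i. c (if i < 3 then i else Suc i))"
  by (simp add: imat_minor_expand_row[of _ "Suc (Suc (Suc 0))"] numeral_eq_Suc)

definition hankel2 :: "'a::comm_ring_1 \<Rightarrow> 'a \<Rightarrow> 'a \<Rightarrow> 'a" where
  "hankel2 x0 x1 x2 = x0 * x2 - x1\<^sup>2"

definition hankel3 :: "'a::comm_ring_1 \<Rightarrow> 'a \<Rightarrow> 'a \<Rightarrow> 'a \<Rightarrow> 'a \<Rightarrow> 'a" where
  "hankel3 x0 x1 x2 x3 x4 =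
     x0 * (x2 * x4 - x3 * x3) - x1 * (x1 * x4 - x2 * x3) + x2 * (x1 * x3 - x2 * x2)"

definition hankel4 :: "'a::comm_ring_1 \<Rightarrow> 'a \<Rightarrow> 'a \<Rightarrow> 'a \<Rightarrow> 'a \<Rightarrow> 'a \<Rightarrow> 'a \<Rightarrow> 'a" where
  "hankel4 x0 x1 x2 x3 x4 x5 x6 =
     x0 * hankel3 x2 x3 x4 x5 x6
     - x1 * (x1 * (x4 * x6 - x5 * x5) - x3 * (x2 * x6 - x5 * x3) + x4 * (x2 * x5 - x4 * x3))
     + x2 * (x1 * (x3 * x6 - x5 * x4) - x2 * (x2 * x6 - x5 * x3) + x4 * (x2 * x4 - x3 * x3))
     - x3 * (x1 * (x3 * x5 - x4 * x4) - x2 * (x2 * x5 - x4 * x3) + x3 * (x2 * x4 - x3 * x3))"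

text \<open>Both identities are instances of the Desnanot--Jacobi identity.\<close>

lemma hankel2_hankel2:
  "hankel2 (hankel2 x0 x1 x2) (hankel2 x1 x2 x3) (hankel2 x2 x3 x4) = x2 * hankel3 x0 x1 x2 x3 x4"
  unfolding hankel2_def hankel3_def by (simp add: algebra_simps power2_eq_square)

lemma hankel2_hankel3:
  "hankel2 (hankel3 x0 x1 x2 x3 x4) (hankel3 x1 x2 x3 x4 x5) (hankel3 x2 x3 x4 x5 x6) =
    hankel2 x2 x3 x4 * hankel4 x0 x1 x2 x3 x4 x5 x6"
  unfolding hankel2_def hankel3_def hankel4_def by (simp add: algebra_simps power2_eq_square)

text \<open>The first iterate is a Hankel determinant of order 2. By the Desnanot--Jacobi identities
  the second is an entry times one of order 3, and the third is one of order 2 times a sum of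
  products of entries and determinants of orders 3 and 4, without a minus sign.\<close>

lemma (in semiring_cone) Lop_funpow_mem:
  assumes "tot_pos (\<lambda>i j. a (i + j))" "k \<le> 3" "k \<le> i"
  shows "(Lop ^^ k) a i \<in> N"
proof -
  \<comment> \<open>Rows \<open>s, s + 1, ...\<close> against columns \<open>0, 1, ...\<close> give
    the Hankel determinants that start at \<open>a s\<close>.\<close>
  have minor: "imat_minor (\<lambda>i j. a (i + j)) k (\<lambda>i. i + s) (\<lambda>j. j) \<in> N" for k s
    using assms(1) by (rule tot_posD) (auto intro!: strict_mono_onI)
  have m1: "a s \<in> N" for s
    using minor[of "Suc 0" s] by (simp add: imat_minor_1)
  have m2: "hankel2 (a s) (a (s + 1)) (a (s + 2)) \<in> N" for s
    using minor[of "Suc (Suc 0)" s] by (simp add: imat_minor_2 hankel2_def power2_eq_square)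
  have m3: "hankel3 (a s) (a (s + 1)) (a (s + 2)) (a (s + 3)) (a (s + 4)) \<in> N" for s
    using minor[of "Suc (Suc (Suc 0))" s] by (simp add: imat_minor_3 hankel3_def numeral_eq_Suc mult_ac)
  have m4: "hankel4 (a s) (a (s + 1)) (a (s + 2)) (a (s + 3)) (a (s + 4)) (a (s + 5)) (a (s + 6)) \<in> N" for s
    using minor[of "Suc (Suc (Suc (Suc 0)))" s]
    by (simp add: imat_minor_4 imat_minor_3 hankel3_def hankel4_def numeral_eq_Suc mult_ac)
  have L: "Lop b (Suc s) = hankel2 (b s) (b (s + 1)) (b (s + 2))" for b :: "nat \<Rightarrow> 'a" and s
    by (simp add: Lop_def hankel2_def)
  have L1: "Lop a (s + 1) = hankel2 (a s) (a (s + 1)) (a (s + 2))" for s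
    using L[of a s] by simp
  have L2: "Lop (Lop a) (s + 2) = a (s + 2) * hankel3 (a s) (a (s + 1)) (a (s + 2)) (a (s + 3)) (a (s + 4))" for s
    using L[of "Lop a" "s + 1"] L1[of s] L1[of "s + 1"] L1[of "s + 2"]
    by (simp add: numeral_eq_Suc hankel2_hankel2)
  have L3: "Lop (Lop (Lop a)) (s + 3) =
      hankel2 (a (s + 2)) (a (s + 3)) (a (s + 4)) *
        (hankel3 (a s) (a (s + 1)) (a (s + 2)) (a (s + 3)) (a (s + 4)) *
         hankel3 (a (s + 2)) (a (s + 3)) (a (s + 4)) (a (s + 5)) (a (s + 6)) +
         a (s + 3) * a (s + 3) *
         hankel4 (a s) (a (s + 1)) (a (s + 2)) (a (s + 3)) (a (s + 4)) (a (s + 5)) (a (s + 6)))" for s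
  proof -
    define x0 x1 x2 x3 x4 x5 x6 where x: "x0 = a s" "x1 = a (s + 1)" "x2 = a (s + 2)" "x3 = a (s + 3)"
      "x4 = a (s + 4)" "x5 = a (s + 5)" "x6 = a (s + 6)"
    have "Lop (Lop (Lop a)) (s + 3) = hankel2 (x2 * hankel3 x0 x1 x2 x3 x4)
        (x3 * hankel3 x1 x2 x3 x4 x5) (x4 * hankel3 x2 x3 x4 x5 x6)"
      using L[of "Lop (Lop a)" "s + 2"] L2[of s] L2[of "s + 1"] L2[of "s + 2"]
      by (simp add: x numeral_eq_Suc)
    \<comment> \<open>Product rule for the operator: its value on \<open>u v\<close> at
      \<open>i\<close> is its value on \<open>u\<close> times \<open>v (i - 1) * v (i + 1)\<close>,
      plus \<open>u i\<close> squared times its value on \<open>v\<close>.\<close>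
    also have "\<dots> = hankel2 x2 x3 x4 * (hankel3 x0 x1 x2 x3 x4 * hankel3 x2 x3 x4 x5 x6) +
        x3 * x3 * hankel2 (hankel3 x0 x1 x2 x3 x4) (hankel3 x1 x2 x3 x4 x5) (hankel3 x2 x3 x4 x5 x6)"
      unfolding hankel2_def[of "_ * _"] hankel2_def[of x2] hankel2_def[of "hankel3 _ _ _ _ _"]
      by (simp add: algebra_simps power2_eq_square)
    finally show ?thesis unfolding hankel2_hankel3 by (simp add: x algebra_simps)
  qed
  obtain s where s: "i = s + k" using assms(3) le_Suc_ex by (metis add.commute)
  consider "k = 0" | "k = 1" | "k = 2" | "k = 3" using assms(2) by linarith
  then show ?thesis
  proof cases
    case 1 then show ?thesis using m1 by simp
  next
    case 2 then show ?thesis using m2[of s] L1[of s] s by simp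
  next
    case 3
    then have "(Lop ^^ k) a i = Lop (Lop a) (s + 2)" using s by (simp add: numeral_eq_Suc)
    then show ?thesis unfolding L2 using mult_mem[OF m1 m3[of s]] by simp
  next
    case 4
    then have "(Lop ^^ k) a i = Lop (Lop (Lop a)) (s + 3)" using s by (simp add: numeral_eq_Suc)
    moreover have "hankel2 (a (s + 2)) (a (s + 3)) (a (s + 4)) \<in> N"
      and "hankel3 (a (s + 2)) (a (s + 3)) (a (s + 4)) (a (s + 5)) (a (s + 6)) \<in> N"
      using m2[of "s + 2"] m3[of "s + 2"] by (simp_all add: numeral_eq_Suc)
    ultimately show ?thesis unfolding L3 using m3[of s] m4[of s] by (simp add: add_mem mult_mem m1)
  qed
qed

text \<open>Gaussian elimination of the first column with pivot \<open>A (r 0) (c 0)\<close>: the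
  matrix is a unipotent lower triangular \<open>E\<close> times an \<open>F\<close> whose first
  column is zero below the pivot.\<close>

lemma imat_minor_schur_complement:
  fixes A :: "real imat"
  assumes r0: "A (r 0) (c 0) \<noteq> 0"
  shows "imat_minor A (Suc k) r c = A (r 0) (c 0) *
    imat_minor (\<lambda>i j. A i j - A i (c 0) * A (r 0) j / A (r 0) (c 0)) k (\<lambda>i. r (Suc i)) (\<lambda>j. c (Suc j))"
proof -
  let ?a = "A (r 0) (c 0)"
  define M where "M = Matrix.mat (Suc k) (Suc k) (\<lambda>(i, j). A (r i) (c j))"
  define E where "E = Matrix.mat (Suc k) (Suc k)
      (\<lambda>(i, j). if i = j then 1 else if j = 0 then A (r i) (c 0) / ?a else 0)"
  define T where "T = (\<lambda>i j. if i = 0 then A (r 0) (c j) else A (r i) (c j) - A (r i) (c 0) * A (r 0) (c j) / ?a)"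
  define F where "F = Matrix.mat (Suc k) (Suc k) (\<lambda>(i, j). T i j)"
  have car: "E \<in> carrier_mat (Suc k) (Suc k)" "F \<in> carrier_mat (Suc k) (Suc k)"
    by (auto simp: E_def F_def)
  have "M = E * F"
  proof (rule eq_matI)
    fix i j assume ij: "i < dim_row (E * F)" "j < dim_col (E * F)"
    then have ij: "i < Suc k" "j < Suc k" by (auto simp: E_def F_def)
    have "(E * F) $$ (i, j) = (\<Sum>l<Suc k. (if i = l then 1 else if l = 0 then A (r i) (c 0) / ?a else 0) * T l j)"
      using ij by (simp add: E_def F_def scalar_prod_def atLeast0LessThan del: sum.lessThan_Suc)
    also have "\<dots> = (\<Sum>l\<in>{0, i}. (if i = l then 1 else if l = 0 then A (r i) (c 0) / ?a else 0) * T l j)"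
      using ij by (intro sum.mono_neutral_right) auto
    also have "\<dots> = A (r i) (c j)"
      using r0 by (cases "i = 0") (auto simp: T_def)
    finally show "M $$ (i, j) = (E * F) $$ (i, j)" using ij by (simp add: M_def)
  qed (auto simp: M_def E_def F_def)
  then have "Determinant.det M = Determinant.det E * Determinant.det F"
    using det_mult[OF car] by simp
  moreover have "Determinant.det E = 1"
  proof -
    have "Determinant.det E = prod_list (diag_mat E)"
      by (rule det_lower_triangular[OF _ car(1)]) (auto simp: E_def)
    also have "\<dots> = 1"
      unfolding prod_list_diag_prod by (auto simp: E_def)
    finally show ?thesis .
  qed
  moreover have "Determinant.det F = ?a * imat_minor (\<lambda>i j. A i j - A i (c 0) * A (r 0) j / ?a) k
      (\<lambda>i. r (Suc i)) (\<lambda>j. c (Suc j))"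
  proof -
    have "Determinant.det F = imat_minor (\<lambda>j i. T i j) (Suc k) id id"
      using imat_minor_transpose[of T "Suc k" id id] by (simp add: imat_minor_def F_def)
    also have "\<dots> = (\<Sum>j\<in>{0}. (-1) ^ j * T j 0 *
        imat_minor (\<lambda>j i. T i j) k (\<lambda>i. id (Suc i)) (\<lambda>i. id (if i < j then i else Suc i)))"
      unfolding imat_minor_expand_row id_apply using r0
      by (intro sum.mono_neutral_right) (auto simp: T_def)
    also have "\<dots> = ?a * imat_minor (\<lambda>j i. T i j) k Suc Suc"
      by (simp add: T_def)
    also have "imat_minor (\<lambda>j i. T i j) k Suc Suc = imat_minor T k Suc Suc"
      by (rule imat_minor_transpose)
    also have "\<dots> = imat_minor (\<lambda>i j. A i j - A i (c 0) * A (r 0) j / ?a) k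
        (\<lambda>i. r (Suc i)) (\<lambda>j. c (Suc j))"
      by (rule imat_minor_cong) (simp add: T_def)
    finally show ?thesis .
  qed
  ultimately show ?thesis by (simp add: imat_minor_def M_def)
qed

text \<open>All principal minors are assumed nonnegative, not just the leading ones, because a pivot
  may vanish. If it does, the minors on 0 and \<open>j + 1\<close> force row 0 to be zero. Otherwise
  completing the square leaves the form of the Schur complement, whose principal minors are those of
  \<open>A\<close> through index 0 divided by the pivot.\<close>

lemma psd_of_principal_minors:
  fixes A :: "real imat"
  assumes "\<And>i j. A i j = A j i"
    and "\<And>k r. strict_mono_on {..<k} r \<Longrightarrow> 0 \<le> imat_minor A k r r"
  shows "0 \<le> (\<Sum>i<n. \<Sum>j<n. x i * x j * A i j)"
  using assms
proof (induction n arbitrary: A x)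
  case 0
  then show ?case by simp
next
  case (Suc n)
  note sym = Suc.prems(1) and minors = Suc.prems(2)
  let ?a = "A 0 0"
  have split: "(\<Sum>i<Suc n. \<Sum>j<Suc n. x i * x j * A i j) = x 0 * x 0 * ?a +
      2 * x 0 * (\<Sum>j<n. x (Suc j) * A 0 (Suc j)) +
      (\<Sum>i<n. \<Sum>j<n. x (Suc i) * x (Suc j) * A (Suc i) (Suc j))"
    unfolding sum.lessThan_Suc_shift using sym[of "Suc _" 0]
    by (simp add: sum.distrib sum_distrib_left mult_ac)
  have a: "0 \<le> ?a" using minors[of "Suc 0" id] by (simp add: imat_minor_1 strict_mono_onI)
  show ?case
  proof (cases "?a = 0")
    case True
    have "A 0 (Suc j) = 0" for j
    proof -
      have "strict_mono_on {..<Suc (Suc 0)} (\<lambda>i. if i = 0 then 0 else Suc j)"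
        by (auto simp: strict_mono_on_def)
      from minors[OF this] have "0 \<le> - (A 0 (Suc j) * A 0 (Suc j))"
        using True sym[of "Suc j" 0] by (simp add: imat_minor_2)
      then show ?thesis by (smt (verit) zero_le_square mult_eq_0_iff)
    qed
    moreover have "0 \<le> (\<Sum>i<n. \<Sum>j<n. x (Suc i) * x (Suc j) * A (Suc i) (Suc j))"
    proof (rule Suc.IH)
      fix k r assume "strict_mono_on {..<k} (r :: nat \<Rightarrow> nat)"
      then have "strict_mono_on {..<k} (\<lambda>i. Suc (r i))" by (auto simp: strict_mono_on_def)
      from minors[OF this] show "0 \<le> imat_minor (\<lambda>i j. A (Suc i) (Suc j)) k r r"
        by (simp add: imat_minor_def)
    qed (simp add: sym[symmetric])
    ultimately show ?thesis unfolding split using True by simp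
  next
    case False
    define S where "S i j = A (Suc i) (Suc j) - A (Suc i) 0 * A 0 (Suc j) / ?a" for i j
    define y where "y = (\<Sum>j<n. x (Suc j) * A 0 (Suc j))"
    have "0 \<le> (\<Sum>i<n. \<Sum>j<n. x (Suc i) * x (Suc j) * S i j)"
    proof (rule Suc.IH)
      show "S i j = S j i" for i j
        using sym[of "Suc i" "Suc j"] sym[of "Suc i" 0] sym[of 0 "Suc j"] by (simp add: S_def)
      fix k r assume r: "strict_mono_on {..<k} (r :: nat \<Rightarrow> nat)"
      define r' where "r' i = (case i of 0 \<Rightarrow> 0 | Suc i \<Rightarrow> Suc (r i))" for i
      have "strict_mono_on {..<Suc k} r'"
        using r by (auto simp: strict_mono_on_def r'_def split: nat.splits)
      moreover have "r' 0 = 0" by (simp add: r'_def)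
      ultimately have "0 \<le> ?a * imat_minor
          (\<lambda>i j. A i j - A i (r' 0) * A (r' 0) j / ?a) k (\<lambda>i. r' (Suc i)) (\<lambda>i. r' (Suc i))"
        using imat_minor_schur_complement[of A r' r' k] minors[of "Suc k" r'] False by simp
      also have "imat_minor (\<lambda>i j. A i j - A i (r' 0) * A (r' 0) j / ?a) k (\<lambda>i. r' (Suc i)) (\<lambda>i. r' (Suc i))
          = imat_minor S k r r"
        by (rule imat_minor_cong) (simp add: S_def r'_def)
      finally show "0 \<le> imat_minor S k r r" using a False by (simp add: zero_le_mult_iff)
    qed
    moreover have "(\<Sum>i<n. \<Sum>j<n. x (Suc i) * x (Suc j) * S i j) =
        (\<Sum>i<n. \<Sum>j<n. x (Suc i) * x (Suc j) * A (Suc i) (Suc j)) - y * y / ?a"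
      unfolding y_def sum_product sum_divide_distrib
      using sym[of "Suc _" 0] by (simp add: S_def right_diff_distrib sum_subtractf mult_ac)
    moreover have "x 0 * x 0 * ?a + 2 * x 0 * y + y * y / ?a = ?a * (x 0 + y / ?a)\<^sup>2"
      using False by (simp add: power2_eq_square field_simps)
    moreover have "0 \<le> ?a * (x 0 + y / ?a)\<^sup>2" using a by simp
    ultimately show ?thesis unfolding split y_def[symmetric] by linarith
  qed
qed

section \<open>Stieltjes' moment theorem\<close>

inductive_set halfline_cone :: "real poly set" where
  square: "r * r \<in> halfline_cone"
| X_square: "[:0, 1:] * (r * r) \<in> halfline_cone"
| add: "p \<in> halfline_cone \<Longrightarrow> r \<in> halfline_cone \<Longrightarrow> p + r \<in> halfline_cone"

text \<open>The only critical product is that of two terms of the second kind, where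
  \<open>X * X\<close> is again a square.\<close>

lemma halfline_cone_mult:
  assumes "p \<in> halfline_cone" "r \<in> halfline_cone"
  shows "p * r \<in> halfline_cone"
  using assms(1)
proof (induction p rule: halfline_cone.induct)
  case (square p)
  show ?case using assms(2)
  proof (induction r rule: halfline_cone.induct)
    case (square r)
    show ?case using halfline_cone.square[of "p * r"] by (simp add: mult_ac)
  next
    case (X_square r)
    show ?case using halfline_cone.X_square[of "p * r"] by (simp add: mult_ac)
  next
    case (add r r')
    then show ?case by (simp add: distrib_left halfline_cone.add)
  qed
next
  case (X_square p)
  show ?case using assms(2)
  proof (induction r rule: halfline_cone.induct)
    case (square r)
    show ?case using halfline_cone.X_square[of "p * r"] by (simp add: mult_ac)
  next
    case (X_square r)
    show ?case using halfline_cone.square[of "[:0, 1:] * (p * r)"] by (simp only: mult_ac)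
  next
    case (add r r')
    then show ?case by (simp only: distrib_left halfline_cone.add)
  qed
next
  case (add p p')
  then show ?case by (simp add: distrib_right halfline_cone.add)
qed

text \<open>Recovers by continuity the sign at a point where it was lost, as at a root after
  cancelling a linear factor.\<close>

lemma poly_nonneg_right:
  fixes p :: "real poly"
  assumes "\<And>x. x > c \<Longrightarrow> 0 \<le> poly p x"
  shows "0 \<le> poly p c"
proof (rule tendsto_lowerbound)
  show "(poly p \<longlongrightarrow> poly p c) (at_right c)"
    by (rule tendsto_within_subset[OF isContD]) auto
  show "eventually (\<lambda>x. 0 \<le> poly p x) (at_right c)"
    using assms by (auto simp: eventually_at_filter intro!: always_eventually)
qed auto

lemma poly_nonpos_left:
  fixes p :: "real poly"
  assumes "b < c" "\<And>x. b < x \<Longrightarrow> x < c \<Longrightarrow> poly p x \<le> 0"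
  shows "poly p c \<le> 0"
proof (rule tendsto_upperbound)
  show "(poly p \<longlongrightarrow> poly p c) (at_left c)"
    by (rule tendsto_within_subset[OF isContD]) auto
  show "eventually (\<lambda>x. poly p x \<le> 0) (at_left c)"
    using eventually_at_left_real[OF assms(1)] by eventually_elim (use assms(2) in auto)
qed auto

text \<open>For a nonreal complex root \<open>z\<close>, division by
  \<open>w = (X - x)^2 + y^2\<close> leaves a real remainder of degree below 2 that vanishes at
  \<open>z\<close>; its imaginary part there kills the linear coefficient, and then the constant one
  is 0.\<close>

lemma real_poly_factor:
  fixes p :: "real poly"
  assumes "degree p > 0"
  obtains (root) c where "poly p c = 0" | (quadratic) x y where "y \<noteq> 0" "[:x\<^sup>2 + y\<^sup>2, - 2 * x, 1:] dvd p"
proof -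
  have hom: "poly (map_poly complex_of_real p) (of_real x) = of_real (poly p x)" for p x
    by (induction p) (simp_all add: map_poly_pCons)
  define P where "P = map_poly complex_of_real p"
  have "degree P = degree p" unfolding P_def by (rule degree_map_poly) auto
  then have "\<not> constant (poly P)" using assms by (simp add: constant_degree)
  then obtain z where z: "poly P z = 0" using fundamental_theorem_of_algebra by blast
  show thesis
  proof (cases "Im z = 0")
    case True
    then have "z = of_real (Re z)" by (simp add: complex_eq_iff)
    then have "poly p (Re z) = 0" using z hom[of p "Re z"] unfolding P_def by (metis of_real_eq_0_iff)
    then show thesis by (rule that(1))
  next
    case False
    define x y where "x = Re z" and "y = Im z"
    define w where "w = [:x\<^sup>2 + y\<^sup>2, - 2 * x, 1:]"
    have hom_mult: "map_poly complex_of_real (f * g) = map_poly complex_of_real f * map_poly complex_of_real g"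
      and hom_add: "map_poly complex_of_real (f + g) = map_poly complex_of_real f + map_poly complex_of_real g"
      for f g
      by (auto intro!: poly_eqI simp: coeff_map_poly coeff_mult)
    have z_eq: "z = Complex x y" by (simp add: x_def y_def)
    have wz: "poly (map_poly complex_of_real w) z = 0"
      by (simp add: w_def map_poly_pCons z_eq complex_eq_iff power2_eq_square algebra_simps)
    define r where "r = p mod w"
    have "p = p div w * w + r" by (simp add: r_def)
    then have "P = map_poly complex_of_real (p div w) * map_poly complex_of_real w + map_poly complex_of_real r"
      unfolding P_def by (metis hom_add hom_mult)
    then have rz: "poly (map_poly complex_of_real r) z = 0" using z wz by simp
    have w2: "degree w = 2" "w \<noteq> 0" by (simp_all add: w_def)
    have "degree r < 2 \<or> r = 0"
      using degree_mod_less[OF w2(2), of p] w2(1) unfolding r_def by auto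
    then have "r = [:coeff r 0, coeff r 1:]"
      by (intro poly_eqI) (auto simp: coeff_pCons coeff_eq_0 split: nat.splits)
    moreover define \<alpha> \<beta> where "\<alpha> = coeff r 0" and "\<beta> = coeff r 1"
    ultimately have r: "r = [:\<alpha>, \<beta>:]" by simp
    have "complex_of_real \<alpha> + z * complex_of_real \<beta> = 0"
      using rz unfolding r by (simp add: map_poly_pCons)
    then have "\<beta> = 0" "\<alpha> = 0" using False by (auto simp: complex_eq_iff)
    then have "w dvd p" using r by (simp add: r_def mod_eq_0_iff_dvd)
    then show thesis using that(2)[of y x] False by (simp add: w_def y_def)
  qed
qed

text \<open>Factors are split off by degree. For a root \<open>c \<le> 0\<close>, the factor
  \<open>X - c\<close> is \<open>-c\<close> plus \<open>X\<close> and lies in the cone. At a root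
  \<open>c > 0\<close> the sign must not change, so the cofactor vanishes at \<open>c\<close> as
  well and a square splits off. A conjugate pair gives a sum of two squares.\<close>

lemma nonneg_poly_in_halfline_cone:
  fixes p :: "real poly"
  assumes "\<And>x. x \<ge> 0 \<Longrightarrow> 0 \<le> poly p x"
  shows "p \<in> halfline_cone"
  using assms
proof (induction "degree p" arbitrary: p rule: less_induct)
  case less
  have const: "[:c:] \<in> halfline_cone" if "0 \<le> c" for c
    using halfline_cone.square[of "[:sqrt c:]"] that by simp
  show ?case
  proof (cases "degree p = 0")
    case True
    then obtain c where "p = [:c:]" by (metis degree_eq_zeroE)
    then show ?thesis using const[of c] less.prems[of 0] by simp
  next
    case False
    then have "p \<noteq> 0" by auto
    from False have "0 < degree p" by simp
    then show ?thesis
    proof (cases rule: real_poly_factor)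
      case (root c)
      then obtain r where r: "p = [:- c, 1:] * r" by (auto simp: poly_eq_0_iff_dvd)
      then have "r \<noteq> 0" using \<open>p \<noteq> 0\<close> by auto
      then have deg: "degree p = Suc (degree r)" unfolding r by (subst degree_mult_eq) auto
      have pr: "poly p x = (x - c) * poly r x" for x by (simp add: r algebra_simps)
      show ?thesis
      proof (cases "c \<le> 0")
        case True
        have pos: "0 \<le> poly r x" if "x > 0" for x
          using less.prems[of x] that True pr[of x] by (simp add: zero_le_mult_iff)
        moreover have "0 \<le> poly r 0" by (rule poly_nonneg_right) (use pos in auto)
        ultimately have "r \<in> halfline_cone"
          using deg by (intro less.hyps) (auto simp: less_eq_real_def)
        moreover have "[:- c:] + [:0, 1:] * (1 * 1) \<in> halfline_cone"
          using const[of "- c"] True by (intro halfline_cone.add halfline_cone.X_square) auto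
        ultimately show ?thesis unfolding r by (intro halfline_cone_mult) simp_all
      next
        case c: False
        have right: "0 \<le> poly r x" if "x > c" for x
          using less.prems[of x] that c pr[of x] by (simp add: zero_le_mult_iff)
        have left: "poly r x \<le> 0" if "0 \<le> x" "x < c" for x
          using less.prems[of x] that pr[of x] by (simp add: zero_le_mult_iff)
        have "0 \<le> poly r c" using right by (rule poly_nonneg_right)
        moreover have "poly r c \<le> 0"
          by (rule poly_nonpos_left[of 0]) (use c left in auto)
        ultimately have "poly r c = 0" by simp
        then obtain s where s: "r = [:- c, 1:] * s" by (auto simp: poly_eq_0_iff_dvd)
        then have "s \<noteq> 0" using \<open>r \<noteq> 0\<close> by auto
        then have deg': "degree r = Suc (degree s)" unfolding s by (subst degree_mult_eq) auto
        have rs: "poly r x = (x - c) * poly s x" for x by (simp add: s algebra_simps)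
        have sr: "0 \<le> poly s x" if "x > c" for x
          using right[OF that] that rs[of x] by (simp add: zero_le_mult_iff)
        moreover have "0 \<le> poly s x" if "0 \<le> x" "x < c" for x
          using left[OF that] that rs[of x] by (simp add: mult_le_0_iff)
        moreover have "0 \<le> poly s c" by (rule poly_nonneg_right) (rule sr)
        ultimately have "s \<in> halfline_cone"
          using deg deg' by (intro less.hyps) (auto, metis linorder_cases)
        then have "[:- c, 1:] * [:- c, 1:] * s \<in> halfline_cone"
          by (intro halfline_cone_mult halfline_cone.square)
        then show ?thesis unfolding r s by (simp only: mult.assoc)
      qed
    next
      case (quadratic x y)
      then obtain r where r: "p = [:x\<^sup>2 + y\<^sup>2, - 2 * x, 1:] * r" by (elim dvdE)
      then have "r \<noteq> 0" using \<open>p \<noteq> 0\<close> by auto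
      then have deg: "degree p = 2 + degree r" unfolding r by (subst degree_mult_eq) auto
      have w: "[:x\<^sup>2 + y\<^sup>2, - 2 * x, 1:] = [:- x, 1:] * [:- x, 1:] + [:y:] * [:y:]"
        by (simp add: power2_eq_square)
      have "0 \<le> poly r t" if "t \<ge> 0" for t
      proof -
        have "0 < (t - x)\<^sup>2 + y\<^sup>2" using quadratic by (simp add: add_nonneg_pos)
        moreover have "poly p t = ((t - x)\<^sup>2 + y\<^sup>2) * poly r t"
          unfolding r poly_mult by (simp add: power2_eq_square algebra_simps)
        ultimately show ?thesis using less.prems[OF that] by (simp add: zero_le_mult_iff)
      qed
      then have "r \<in> halfline_cone" using deg by (intro less.hyps) auto
      moreover have "[:- x, 1:] * [:- x, 1:] + [:y:] * [:y:] \<in> halfline_cone"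
        by (intro halfline_cone.add halfline_cone.square)
      ultimately show ?thesis unfolding r w by (intro halfline_cone_mult)
    qed
  qed
qed

section \<open>The Riesz functional of a sequence\<close>

definition moment_functional :: "(nat \<Rightarrow> real) \<Rightarrow> real poly \<Rightarrow> real" where
  "moment_functional a p = (\<Sum>i\<le>degree p. coeff p i * a i)"

lemma moment_functional_bound:
  "degree p \<le> n \<Longrightarrow> moment_functional a p = (\<Sum>i\<le>n. coeff p i * a i)"
  unfolding moment_functional_def by (intro sum.mono_neutral_left) (auto simp: coeff_eq_0)

lemma moment_functional_add:
  "moment_functional a (p + r) = moment_functional a p + moment_functional a r"
proof -
  let ?n = "max (degree p) (degree r)"
  show ?thesis
    using moment_functional_bound[of "p + r" ?n a] moment_functional_bound[of p ?n a]
      moment_functional_bound[of r ?n a] degree_add_le_max[of p r]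
    by (simp add: distrib_right sum.distrib)
qed

lemma moment_functional_sum:
  "moment_functional a (\<Sum>i\<in>I. p i) = (\<Sum>i\<in>I. moment_functional a (p i))"
proof (induction I rule: infinite_finite_induct)
  case (insert i I)
  then show ?case by (simp add: moment_functional_add)
qed (simp_all add: moment_functional_def)

lemma moment_functional_monom: "moment_functional a (Polynomial.monom c n) = c * a n"
  using moment_functional_bound[of "Polynomial.monom c n" n a] degree_monom_le[of c n]
  by (simp add: if_distrib if_distribR cong: if_cong)

lemma moment_functional_monom_square:
  "moment_functional a (Polynomial.monom 1 e * (r * r)) =
    (\<Sum>i<Suc (degree r). \<Sum>j<Suc (degree r). coeff r i * coeff r j * a (i + j + e))"
proof -
  let ?n = "Suc (degree r)"
  have "r = (\<Sum>i<?n. Polynomial.monom (coeff r i) i)"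
    using poly_as_sum_of_monoms[of r] by (simp only: lessThan_Suc_atMost)
  then have "r * r = (\<Sum>i<?n. Polynomial.monom (coeff r i) i) * (\<Sum>j<?n. Polynomial.monom (coeff r j) j)"
    by simp
  also have "\<dots> = (\<Sum>i<?n. \<Sum>j<?n. Polynomial.monom (coeff r i * coeff r j) (i + j))"
    by (simp only: sum_product mult_monom)
  finally have "Polynomial.monom 1 e * (r * r) =
      (\<Sum>i<?n. \<Sum>j<?n. Polynomial.monom (coeff r i * coeff r j) (i + j + e))"
    by (simp add: sum_distrib_left mult_monom add_ac del: sum.lessThan_Suc)
  then show ?thesis
    by (simp add: moment_functional_sum moment_functional_monom del: sum.lessThan_Suc)
qed

text \<open>On the two kinds of generators of the cone the functional is exactly the Hankel form of
  \<open>a\<close> and that of the shifted sequence.\<close>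

lemma moment_functional_nonneg:
  assumes "\<And>n c. 0 \<le> (\<Sum>i<n. \<Sum>j<n. c i * c j * a (i + j))"
    and "\<And>n c. 0 \<le> (\<Sum>i<n. \<Sum>j<n. c i * c j * a (i + j + 1))"
    and "\<And>x. x \<ge> 0 \<Longrightarrow> 0 \<le> poly p x"
  shows "0 \<le> moment_functional a p"
proof -
  have "p \<in> halfline_cone" using assms(3) by (rule nonneg_poly_in_halfline_cone)
  then show ?thesis
  proof (induction p rule: halfline_cone.induct)
    case (square r)
    show ?case using moment_functional_monom_square[where a = a and e = 0 and r = r] assms(1)
        by (simp del: sum.lessThan_Suc)
  next
    case (X_square r)
    have "[:0, 1:] = Polynomial.monom (1::real) 1" by (simp add: monom_Suc monom_0)
    then show ?case using moment_functional_monom_square[where a = a and e = 1 and r = r] assms(2)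
        by (simp del: sum.lessThan_Suc)
  next
    case (add p r)
    then show ?case by (simp add: moment_functional_add)
  qed
qed

section \<open>Approximation by finitely supported measures\<close>

definition atomic_moments :: "(nat \<Rightarrow> real) set" where
  "atomic_moments = {(\<lambda>i. \<Sum>x\<in>S. w x * x ^ i) |S w. finite S \<and> (\<forall>x\<in>S. 0 \<le> x \<and> 0 \<le> w x)}"

lemma atomic_moments_scale:
  assumes "m \<in> atomic_moments" "0 \<le> t"
  shows "(\<lambda>i. t * m i) \<in> atomic_moments"
proof -
  obtain S w where "finite S" "\<forall>x\<in>S. 0 \<le> x \<and> 0 \<le> w x" "m = (\<lambda>i. \<Sum>x\<in>S. w x * x ^ i)"
    using assms(1) by (auto simp: atomic_moments_def)
  then show ?thesis unfolding atomic_moments_def using assms(2)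
    by (intro CollectI exI[of _ S] exI[of _ "\<lambda>x. t * w x"]) (auto simp: sum_distrib_left mult.assoc)
qed

lemma atomic_moments_add_atom:
  assumes "m \<in> atomic_moments" "0 \<le> t" "0 \<le> y"
  shows "(\<lambda>i. m i + t * y ^ i) \<in> atomic_moments"
proof -
  obtain S w where S: "finite S" "\<forall>x\<in>S. 0 \<le> x \<and> 0 \<le> w x" "m = (\<lambda>i. \<Sum>x\<in>S. w x * x ^ i)"
    using assms(1) by (auto simp: atomic_moments_def)
  define w' where "w' x = (if x \<in> S then w x else 0) + (if x = y then t else 0)" for x
  have "(\<Sum>x\<in>insert y S. w' x * x ^ i) = m i + t * y ^ i" for i
  proof -
    have "(\<Sum>x\<in>insert y S. w' x * x ^ i) = (\<Sum>x\<in>insert y S. (if x \<in> S then w x else 0) * x ^ i) +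
        (\<Sum>x\<in>insert y S. if x = y then t * y ^ i else 0)"
      unfolding sum.distrib[symmetric] w'_def by (intro sum.cong) (auto simp: distrib_right)
    also have "(\<Sum>x\<in>insert y S. (if x \<in> S then w x else 0) * x ^ i) = m i"
      unfolding S(3) using S(1) by (intro sum.mono_neutral_cong_right) auto
    finally show ?thesis using S(1) by simp
  qed
  moreover have "finite (insert y S)" "\<forall>x\<in>insert y S. 0 \<le> x \<and> 0 \<le> w' x"
    using S assms by (auto simp: w'_def)
  ultimately show ?thesis unfolding atomic_moments_def
    by (intro CollectI exI[of _ "insert y S"] exI[of _ w']) simp
qed

text \<open>
  A near minimizer of the distance from the moments up to order \<open>n\<close> to the cone of moments of
  atomic measures on the half line: the deviation, perturbed slightly, is a polynomial that is
  nonnegative on the half line, which forces the distance to be \<open>0\<close>.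
\<close>

lemma atomic_moments_approx:
  fixes a :: "nat \<Rightarrow> real"
  assumes pos: "\<And>p. (\<And>x. x \<ge> 0 \<Longrightarrow> 0 \<le> poly p x) \<Longrightarrow> 0 \<le> moment_functional a p"
    and "0 < \<epsilon>"
  shows "\<exists>m\<in>atomic_moments. \<forall>i\<le>n. \<bar>a i - m i\<bar> < \<epsilon>"
proof -
  define D where "D m = (\<Sum>i\<le>n. (a i - m i)\<^sup>2)" for m
  define d where "d = Inf (D ` atomic_moments)"
  have ne: "D ` atomic_moments \<noteq> {}"
    unfolding atomic_moments_def by auto
  have bdd: "bdd_below (D ` atomic_moments)"
    by (rule bdd_belowI[of _ 0]) (auto simp: D_def sum_nonneg)
  have le: "d \<le> D m" if "m \<in> atomic_moments" for m
    unfolding d_def using that bdd by (intro cInf_lower) auto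
  have near: "\<exists>m\<in>atomic_moments. D m < y" if "d < y" for y
    using cInf_lessD[OF ne] that unfolding d_def by auto
  have d0: "0 \<le> d" unfolding d_def using ne by (intro cInf_greatest) (auto simp: D_def sum_nonneg)
  \<comment> \<open>Collects three bounds found below: \<open>ca\<close>, half of \<open>cm\<close>,
    and the estimate of the squares of the \<open>m i\<close> by
    \<open>2 * (\<Sum>i\<le>n. (a i)\<^sup>2) + 2 * d + 2\<close>.\<close>
  define A where "A = (\<Sum>i\<le>n. a i) + (3 + 2 * (\<Sum>i\<le>n. (a i)\<^sup>2) + 2 * d) / 2"
  have key: "d \<le> \<eta> * A" if \<eta>: "0 < \<eta>" "\<eta> \<le> 1" for \<eta>
  proof -
    \<comment> \<open>The truncated moment cone need not be closed, since mass may escape to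
      infinity in the top moment; a minimizer up to a slack of order two in \<open>\<eta>\<close>
      replaces an exact one.\<close>
    have "d < d + \<eta>\<^sup>2" using \<eta> by simp
    then obtain m where m: "m \<in> atomic_moments" "D m < d + \<eta>\<^sup>2"
      using near by blast
    define c where "c i = a i - m i" for i
    have D: "D m = (\<Sum>i\<le>n. (c i)\<^sup>2)" by (simp add: D_def c_def)
    have atom: "(\<Sum>i\<le>n. c i * x ^ i) \<le> \<eta> * (\<Sum>i\<le>n. x ^ i)" if x: "0 \<le> x" for x
    proof -
      define V where "V = (\<Sum>i\<le>n. x ^ i)"
      have "(\<Sum>i\<in>{0}. x ^ i) \<le> V" unfolding V_def using x by (intro sum_mono2) auto
      then have V: "1 \<le> V" by simp
      \<comment> \<open>With this weight the quadratic cost of adding an atom at \<open>x\<close> is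
        at most \<open>\<eta>\<^sup>2\<close>, which matches the slack of \<open>m\<close>.\<close>
      define t where "t = \<eta> / V"
      have t: "0 \<le> t" "t * V = \<eta>" "0 < t" using \<eta> V by (auto simp: t_def)
      have sq: "(\<Sum>i\<le>n. (x ^ i)\<^sup>2) \<le> V\<^sup>2"
      proof -
        have "(\<Sum>i\<le>n. (x ^ i)\<^sup>2) \<le> (\<Sum>i\<le>n. x ^ i * V)"
        proof (rule sum_mono)
          fix i assume "i \<in> {..n}"
          then have "x ^ i \<le> V" unfolding V_def using x by (intro member_le_sum) auto
          then show "(x ^ i)\<^sup>2 \<le> x ^ i * V"
            using x by (simp add: power2_eq_square mult_left_mono)
        qed
        then show ?thesis by (simp add: V_def power2_eq_square sum_distrib_right)
      qed
      have "D m - \<eta>\<^sup>2 \<le> D (\<lambda>i. m i + t * x ^ i)"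
        using m(2) le[OF atomic_moments_add_atom[OF m(1) t(1) x]] by simp
      also have "\<dots> = D m - 2 * t * (\<Sum>i\<le>n. c i * x ^ i) + t\<^sup>2 * (\<Sum>i\<le>n. (x ^ i)\<^sup>2)"
        unfolding D_def c_def sum_distrib_left sum_subtractf[symmetric] sum.distrib[symmetric]
        by (intro sum.cong refl) (simp add: power2_eq_square algebra_simps)
      also have "\<dots> \<le> D m - 2 * t * (\<Sum>i\<le>n. c i * x ^ i) + t\<^sup>2 * V\<^sup>2"
        using sq by (simp add: mult_left_mono)
      also have "t\<^sup>2 * V\<^sup>2 = \<eta>\<^sup>2" using t(2) by (simp flip: power_mult_distrib)
      finally have "t * (\<Sum>i\<le>n. c i * x ^ i) \<le> \<eta> * \<eta>"
        by (simp add: power2_eq_square)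
      also have "\<eta> * \<eta> = t * (\<eta> * V)" by (subst (1) t(2)[symmetric]) (simp only: mult_ac)
      finally have "t * (\<Sum>i\<le>n. c i * x ^ i) \<le> t * (\<eta> * V)" .
      then show ?thesis using t(3) unfolding V_def by simp
    qed
    \<comment> \<open>By \<open>atom\<close> this perturbed deviation is nonnegative on the half
      line, so the hypothesis on \<open>a\<close> applies to it.\<close>
    define p where "p = (\<Sum>i\<le>n. Polynomial.monom (\<eta> - c i) i)"
    have "poly p x = \<eta> * (\<Sum>i\<le>n. x ^ i) - (\<Sum>i\<le>n. c i * x ^ i)" for x
      by (simp add: p_def poly_sum poly_monom sum_distrib_left sum_subtractf left_diff_distrib)
    then have "0 \<le> moment_functional a p" using atom by (intro pos) simp
    then have ca: "(\<Sum>i\<le>n. c i * a i) \<le> \<eta> * (\<Sum>i\<le>n. a i)"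
      by (simp add: p_def moment_functional_sum moment_functional_monom sum_distrib_left
          sum_subtractf left_diff_distrib)
    \<comment> \<open>Moving within the cone along the ray through \<open>m\<close> shows that the
      inner product of \<open>c\<close> and \<open>m\<close> is almost nonnegative.\<close>
    have "D m - \<eta>\<^sup>2 \<le> D (\<lambda>i. (1 - \<eta>) * m i)"
      using m(2) le[OF atomic_moments_scale[OF m(1), of "1 - \<eta>"]] \<eta> by simp
    also have "\<dots> = D m + 2 * \<eta> * (\<Sum>i\<le>n. c i * m i) + \<eta>\<^sup>2 * (\<Sum>i\<le>n. (m i)\<^sup>2)"
      unfolding D_def c_def sum_distrib_left sum.distrib[symmetric]
      by (intro sum.cong refl) (simp add: power2_eq_square algebra_simps)
    finally have "\<eta> * 0 \<le> \<eta> * (\<eta> + 2 * (\<Sum>i\<le>n. c i * m i) + \<eta> * (\<Sum>i\<le>n. (m i)\<^sup>2))"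
      by (simp add: power2_eq_square algebra_simps)
    then have cm: "0 \<le> \<eta> + 2 * (\<Sum>i\<le>n. c i * m i) + \<eta> * (\<Sum>i\<le>n. (m i)\<^sup>2)"
      using \<eta>(1) by (simp only: mult_le_cancel_left_pos)
    have "(\<Sum>i\<le>n. (m i)\<^sup>2) \<le> (\<Sum>i\<le>n. 2 * (a i)\<^sup>2 + 2 * (c i)\<^sup>2)"
    proof (rule sum_mono)
      fix i
      have "2 * (a i)\<^sup>2 + 2 * (c i)\<^sup>2 - (m i)\<^sup>2 = (a i + c i)\<^sup>2"
        by (simp add: c_def power2_eq_square algebra_simps)
      then show "(m i)\<^sup>2 \<le> 2 * (a i)\<^sup>2 + 2 * (c i)\<^sup>2" by (smt (verit) zero_le_power2)
    qed
    also have "\<dots> = 2 * (\<Sum>i\<le>n. (a i)\<^sup>2) + 2 * D m"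
      by (simp add: D sum.distrib sum_distrib_left)
    also have "\<dots> \<le> 2 * (\<Sum>i\<le>n. (a i)\<^sup>2) + 2 * d + 2"
      using m(2) \<eta> power_le_one[of \<eta> 2] by simp
    finally have "\<eta> * (\<Sum>i\<le>n. (m i)\<^sup>2) \<le> \<eta> * (2 * (\<Sum>i\<le>n. (a i)\<^sup>2) + 2 * d + 2)"
      using \<eta> by (simp add: mult_left_mono)
    moreover have "d \<le> (\<Sum>i\<le>n. c i * a i) - (\<Sum>i\<le>n. c i * m i)"
    proof -
      have "D m = (\<Sum>i\<le>n. c i * a i) - (\<Sum>i\<le>n. c i * m i)"
        unfolding D sum_subtractf[symmetric]
        by (intro sum.cong refl) (simp add: c_def power2_eq_square algebra_simps)
      then show ?thesis using le[OF m(1)] by simp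
    qed
    ultimately show ?thesis using ca cm by (simp add: A_def field_simps)
  qed
  have "d = 0"
  proof (rule ccontr)
    assume "d \<noteq> 0"
    then have d: "0 < d" using d0 by simp
    define \<eta> where "\<eta> = min 1 (d / (2 * (\<bar>A\<bar> + 1)))"
    have \<eta>: "0 < \<eta>" "\<eta> \<le> 1" using d by (auto simp: \<eta>_def)
    have "d \<le> \<eta> * \<bar>A\<bar>" using key[OF \<eta>] \<eta> by (smt (verit) mult_left_mono)
    also have "\<dots> \<le> d / (2 * (\<bar>A\<bar> + 1)) * (\<bar>A\<bar> + 1)"
      by (rule mult_mono) (use d in \<open>auto simp: \<eta>_def\<close>)
    also have "\<dots> = d / 2"
    proof -
      have "\<bar>A\<bar> + 1 \<noteq> 0" by linarith
      then show ?thesis by (simp add: field_simps)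
    qed
    finally show False using d by simp
  qed
  then have "d < \<epsilon>\<^sup>2" using assms(2) by simp
  then obtain m where m: "m \<in> atomic_moments" "D m < \<epsilon>\<^sup>2"
    using near by blast
  have "\<bar>a i - m i\<bar> < \<epsilon>" if "i \<le> n" for i
  proof -
    have "(a i - m i)\<^sup>2 \<le> D m" unfolding D_def using that by (intro member_le_sum) auto
    then have "\<bar>a i - m i\<bar>\<^sup>2 < \<epsilon>\<^sup>2" using m(2) by simp
    then show ?thesis using assms(2) by (intro power_less_imp_less_base[of _ 2 \<epsilon>]) auto
  qed
  then show ?thesis using m(1) by blast
qed

section \<open>From atomic measures to a limit measure\<close>

lemma atomic_distribution:
  fixes S :: "real set" and w :: "real \<Rightarrow> real"
  assumes "finite S" "\<And>x. x \<in> S \<Longrightarrow> 0 \<le> w x" "(\<Sum>x\<in>S. w x) = 1"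
  obtains M where "real_distribution M"
    "\<And>f :: real \<Rightarrow> real. f \<in> borel_measurable borel \<Longrightarrow> integral\<^sup>L M f = (\<Sum>x\<in>S. w x * f x)"
proof -
  define g where "g x = (if x \<in> S then w x else 0)" for x
  have g0: "0 \<le> g x" for x using assms(2) by (simp add: g_def)
  have "(\<integral>\<^sup>+ x. ennreal (g x) \<partial>count_space UNIV) = (\<Sum>x\<in>S. ennreal (g x))"
    by (rule nn_integral_count_space'[OF assms(1)]) (auto simp: g_def)
  also have "\<dots> = ennreal (\<Sum>x\<in>S. g x)" by (rule sum_ennreal) (rule g0)
  also have "(\<Sum>x\<in>S. g x) = 1" using assms(3) by (simp add: g_def)
  finally have g1: "(\<integral>\<^sup>+ x. ennreal (g x) \<partial>count_space UNIV) = 1" by simp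
  define p where "p = embed_pmf g"
  have p: "pmf p x = g x" for x unfolding p_def by (rule pmf_embed_pmf[OF g0 g1])
  \<comment> \<open>A \<open>measure_pmf\<close> has every set measurable; the push-forward along
    the identity restricts it to the Borel sets.\<close>
  define M where "M = distr (measure_pmf p) borel (\<lambda>x. x)"
  have "integral\<^sup>L M f = (\<Sum>x\<in>S. w x * f x)" if f: "f \<in> borel_measurable borel" for f :: "real \<Rightarrow> real"
  proof -
    have "integral\<^sup>L M f = (\<integral>x. f x \<partial>measure_pmf p)"
      unfolding M_def by (subst integral_distr) (use f in auto)
    also have "\<dots> = (\<Sum>x\<in>S. f x * pmf p x)"
      by (rule integral_measure_pmf_real[OF assms(1)]) (auto simp: set_pmf_iff p g_def split: if_splits)
    finally show ?thesis by (simp add: p g_def mult.commute)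
  qed
  moreover have "real_distribution M"
    unfolding M_def by (rule prob_space.real_distribution_distr) (auto intro: measure_pmf.prob_space_axioms)
  ultimately show thesis by (rule that[rotated])
qed

text \<open>Bounded first moments give tightness, hence a weak limit along a subsequence. Powers are
  unbounded, so weak convergence is applied to truncated powers; the moment of order
  \<open>k + 1\<close> controls the error in order \<open>k\<close>, and monotone convergence
  removes the truncation.\<close>

lemma weak_limit_moments:
  fixes \<mu> :: "nat \<Rightarrow> real measure" and S :: "nat \<Rightarrow> real set" and w :: "nat \<Rightarrow> real \<Rightarrow> real"
  assumes \<mu>: "\<And>n. real_distribution (\<mu> n)"
    and S: "\<And>n. finite (S n)" "\<And>n x. x \<in> S n \<Longrightarrow> 0 \<le> x \<and> 0 \<le> w n x"
    and integral: "\<And>n (f :: real \<Rightarrow> real). f \<in> borel_measurable borel \<Longrightarrow> integral\<^sup>L (\<mu> n) f = (\<Sum>x\<in>S n. w n x * f x)"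
    and lim: "\<And>k. (\<lambda>n. \<Sum>x\<in>S n. w n x * x ^ k) \<longlonglongrightarrow> a k"
  obtains M where "real_distribution M" "AE x in M. 0 \<le> x"
    "\<And>k. integrable M (\<lambda>x. max 0 x ^ k)" "\<And>k. integral\<^sup>L M (\<lambda>x. max 0 x ^ k) = a k"
proof -
  have mass: "(\<Sum>x\<in>S n. w n x) = 1" for n
  proof -
    interpret real_distribution "\<mu> n" by (rule \<mu>)
    have "integral\<^sup>L (\<mu> n) (\<lambda>x. 1 :: real) = 1" using prob_space by simp
    then show ?thesis using integral[of "\<lambda>x. 1" n] by simp
  qed
  obtain B where B: "0 < B" "\<And>n. \<bar>\<Sum>x\<in>S n. w n x * x\<bar> \<le> B"
    using convergent_imp_Bseq[OF convergentI[OF lim[of 1]]] by (auto elim!: BseqE)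
  have "tight \<mu>"
    unfolding tight_def
  proof (intro conjI allI impI)
    fix \<epsilon> :: real assume \<epsilon>: "0 < \<epsilon>"
    \<comment> \<open>Markov's inequality leaves mass at most \<open>B / b = \<epsilon> / 2\<close>
      above \<open>b\<close>; the left end \<open>-1\<close> keeps the atom at 0 inside the
      half-open interval.\<close>
    define b where "b = 2 * B / \<epsilon>"
    have b: "0 < b" using B \<epsilon> by (simp add: b_def)
    have "1 - \<epsilon> < measure (\<mu> n) {-1<..b}" for n
    proof -
      interpret real_distribution "\<mu> n" by (rule \<mu>)
      have "1 - measure (\<mu> n) {-1<..b} = (\<Sum>x\<in>S n. w n x * (1 - indicator {-1<..b} x))"
        using integral[of "indicator {-1<..b}" n] mass[of n]
        by (simp add: right_diff_distrib sum_subtractf)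
      also have "\<dots> \<le> (\<Sum>x\<in>S n. w n x * (x / b))"
      proof (rule sum_mono)
        fix x assume "x \<in> S n"
        then show "w n x * (1 - indicator {-1<..b} x) \<le> w n x * (x / b)"
          using S(2)[of x n] b by (intro mult_left_mono) (auto simp: indicator_def)
      qed
      also have "\<dots> = (\<Sum>x\<in>S n. w n x * x) / b" by (simp add: sum_divide_distrib)
      also have "\<dots> \<le> B / b" using B(2)[of n] b by (intro divide_right_mono) auto
      also have "\<dots> = \<epsilon> / 2" using B \<epsilon> by (simp add: b_def)
      finally show ?thesis using \<epsilon> by simp
    qed
    then show "\<exists>a b. a < b \<and> (\<forall>n. 1 - \<epsilon> < measure (\<mu> n) {a<..b})"
      using b by (intro exI[of _ "-1"] exI[of _ b]) auto
  qed (rule \<mu>)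
  from tight_imp_convergent_subsubsequence[OF this strict_mono_id] obtain r M where
    r: "strict_mono (r :: nat \<Rightarrow> nat)" and M: "real_distribution M" and conv: "weak_conv_m (\<mu> \<circ> id \<circ> r) M"
    by blast
  interpret M: real_distribution M by (rule M)
  have weak: "(\<lambda>n. \<Sum>x\<in>S (r n). w (r n) x * f x) \<longlonglongrightarrow> integral\<^sup>L M f"
    if "continuous_on UNIV f" "\<And>x. \<bar>f x\<bar> \<le> C" for f :: "real \<Rightarrow> real" and C
  proof -
    have "(\<lambda>n. integral\<^sup>L ((\<mu> \<circ> id \<circ> r) n) f) \<longlonglongrightarrow> integral\<^sup>L M f"
      using \<mu> M conv that
      by (intro weak_conv_imp_integral_bdd_continuous_conv[where B = C])
         (auto simp: continuous_on_eq_continuous_at comp_def)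
    then show ?thesis using that(1) by (simp add: integral borel_measurable_continuous_onI)
  qed
  have int: "integrable M f" if "continuous_on UNIV f" "\<And>x. \<bar>f x\<bar> \<le> C" for f :: "real \<Rightarrow> real" and C
  proof (rule M.integrable_const_bound[where B = C])
    show "f \<in> borel_measurable M"
      using borel_measurable_continuous_onI[OF that(1)]
      by (simp add: measurable_cong_sets[OF M.events_eq_borel refl])
  qed (use that in auto)
  \<comment> \<open>A bounded continuous function that vanishes exactly on the half line: its
    integral against the limit being 0 confines the limit to the half line.\<close>
  define neg where "neg x = min 1 (max 0 (- x))" for x :: real
  have neg: "continuous_on UNIV neg" "\<And>x. \<bar>neg x\<bar> \<le> 1"
    unfolding neg_def by (intro continuous_intros) auto
  have "(\<Sum>x\<in>S (r n). w (r n) x * neg x) = 0" for n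
    using S(2) by (intro sum.neutral) (auto simp: neg_def)
  then have "(\<lambda>n. 0) \<longlonglongrightarrow> integral\<^sup>L M neg" using weak[OF neg] by simp
  then have "integral\<^sup>L M neg = 0" by (simp add: LIMSEQ_const_iff)
  then have "AE x in M. neg x = 0"
    using integral_nonneg_eq_0_iff_AE[OF int[OF neg]] by (simp add: neg_def)
  then have AE: "AE x in M. 0 \<le> x" by eventually_elim (auto simp: neg_def min_def max_def split: if_splits)
  have "integrable M (\<lambda>x. max 0 x ^ k) \<and> integral\<^sup>L M (\<lambda>x. max 0 x ^ k) = a k" for k
  proof -
    define g where "g R x = (min (real (Suc R)) (max 0 x)) ^ k" for R and x :: real
    have g: "continuous_on UNIV (g R)" "\<bar>g R x\<bar> \<le> real (Suc R) ^ k" for R x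
    proof -
      show "continuous_on UNIV (g R)" unfolding g_def by (intro continuous_intros)
      show "\<bar>g R x\<bar> \<le> real (Suc R) ^ k" unfolding g_def power_abs by (intro power_mono) auto
    qed
    have limr: "(\<lambda>n. \<Sum>x\<in>S (r n). w (r n) x * x ^ j) \<longlonglongrightarrow> a j" for j
      using LIMSEQ_subseq_LIMSEQ[OF lim[of j] r] by (simp add: comp_def)
    have upper: "integral\<^sup>L M (g R) \<le> a k" for R
    proof (rule LIMSEQ_le[OF weak[OF g(1) g(2)] limr], intro exI allI impI sum_mono mult_left_mono)
      fix n x assume "x \<in> S (r n)"
      then show "g R x \<le> x ^ k" "0 \<le> w (r n) x"
        using S(2)[of x "r n"] by (auto simp: g_def intro!: power_mono)
    qed
    \<comment> \<open>For \<open>x\<close> beyond \<open>Suc R\<close> the left-hand integrand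
      \<open>x ^ k - x ^ Suc k / real (Suc R)\<close> is not positive; below, the truncation is
      inactive.\<close>
    have lower: "a k - a (Suc k) / real (Suc R) \<le> integral\<^sup>L M (g R)" for R
    proof (rule LIMSEQ_le[OF _ weak[OF g(1) g(2)]])
      show "(\<lambda>n. (\<Sum>x\<in>S (r n). w (r n) x * x ^ k) - (\<Sum>x\<in>S (r n). w (r n) x * x ^ Suc k) / real (Suc R))
          \<longlonglongrightarrow> a k - a (Suc k) / real (Suc R)"
        by (intro tendsto_intros limr) auto
      show "\<exists>N. \<forall>n\<ge>N. (\<Sum>x\<in>S (r n). w (r n) x * x ^ k) -
          (\<Sum>x\<in>S (r n). w (r n) x * x ^ Suc k) / real (Suc R) \<le> (\<Sum>x\<in>S (r n). w (r n) x * g R x)"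
      proof (intro exI allI impI)
        fix n
        have "(\<Sum>x\<in>S (r n). w (r n) x * x ^ k) - (\<Sum>x\<in>S (r n). w (r n) x * x ^ Suc k) / real (Suc R) =
            (\<Sum>x\<in>S (r n). w (r n) x * (x ^ k - x ^ Suc k / real (Suc R)))"
          by (simp add: sum_divide_distrib sum_subtractf right_diff_distrib)
        also have "\<dots> \<le> (\<Sum>x\<in>S (r n). w (r n) x * g R x)"
        proof (intro sum_mono mult_left_mono)
          fix x assume "x \<in> S (r n)"
          then have x: "0 \<le> x" "0 \<le> w (r n) x" using S(2)[of x "r n"] by auto
          show "0 \<le> w (r n) x" by (rule x)
          show "x ^ k - x ^ Suc k / real (Suc R) \<le> g R x"
          proof (cases "x \<le> real (Suc R)")
            case True
            then show ?thesis using x by (simp add: g_def)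
          next
            case False
            then have "x ^ k * 1 \<le> x ^ k * (x / real (Suc R))"
              using x by (intro mult_left_mono) auto
            then have "x ^ k - x ^ Suc k / real (Suc R) \<le> 0" by (simp add: mult.commute)
            also have "0 \<le> g R x" using x by (simp add: g_def)
            finally show ?thesis .
          qed
        qed
        finally show "(\<Sum>x\<in>S (r n). w (r n) x * x ^ k) - (\<Sum>x\<in>S (r n). w (r n) x * x ^ Suc k) / real (Suc R)
            \<le> (\<Sum>x\<in>S (r n). w (r n) x * g R x)" .
      qed
    qed
    have lim_g: "(\<lambda>R. integral\<^sup>L M (g R)) \<longlonglongrightarrow> a k"
    proof (rule tendsto_sandwich[where f = "\<lambda>R. a k - a (Suc k) / real (Suc R)" and h = "\<lambda>_. a k"])
      have "(\<lambda>R. a k - a (Suc k) / real (Suc R)) \<longlonglongrightarrow> a k - 0"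
        by (intro tendsto_intros LIMSEQ_Suc[OF lim_const_over_n])
      then show "(\<lambda>R. a k - a (Suc k) / real (Suc R)) \<longlonglongrightarrow> a k" by simp
    qed (use upper lower in auto)
    have mono: "AE x in M. mono (\<lambda>R. g R x)"
      unfolding g_def mono_def by (auto intro!: power_mono)
    have pt: "AE x in M. (\<lambda>R. g R x) \<longlonglongrightarrow> max 0 x ^ k"
    proof (rule AE_I2)
      fix x
      obtain N where N: "x \<le> real N" using real_arch_simple by blast
      have "eventually (\<lambda>R. g R x = max 0 x ^ k) sequentially"
        using eventually_ge_at_top[of N]
      proof eventually_elim
        case (elim R)
        then have "max 0 x \<le> real (Suc R)" using N by simp
        then show ?case by (simp add: g_def min_absorb2)
      qed
      then show "(\<lambda>R. g R x) \<longlonglongrightarrow> max 0 x ^ k" by (rule tendsto_eventually)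
    qed
    have meas: "(\<lambda>x. max 0 x ^ k) \<in> borel_measurable M" by measurable
    show ?thesis
      using integrable_monotone_convergence[OF int[OF g(1) g(2)] mono pt lim_g meas]
        integral_monotone_convergence[OF int[OF g(1) g(2)] mono pt lim_g meas] by simp
  qed
  then show thesis using that[OF M AE] by blast
qed

lemma stieltjes_moment_zero: "stieltjes_moment (\<lambda>n. 0)"
  unfolding stieltjes_moment_def
proof (intro exI conjI allI)
  let ?\<mu> = "null_measure borel :: real measure"
  show "sets ?\<mu> = sets borel" by simp
  fix n
  have AE: "AE x in ?\<mu>. indicat_real {0..} x *\<^sub>R x ^ n = 0"
    by (rule AE_I[of _ _ "space ?\<mu>"]) auto
  show "set_integrable ?\<mu> {0..} (\<lambda>x. x ^ n)"
    unfolding set_integrable_def using AE by (subst integrable_cong_AE[where g = "\<lambda>_. 0"]) auto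
  show "0 = (LINT x:{0..}|?\<mu>. x ^ n)"
    unfolding set_lebesgue_integral_def using integral_eq_zero_AE[OF AE] by simp
qed

text \<open>Atomic measures matching the first moments ever better are normalized to probability
  measures, and a weak limit is scaled back by \<open>a 0\<close>. The case \<open>a 0 = 0\<close>,
  where normalization is impossible, forces the zero sequence.\<close>

theorem stieltjes_moment_if_psd:
  fixes a :: "nat \<Rightarrow> real"
  assumes psd0: "\<And>n c. 0 \<le> (\<Sum>i<n. \<Sum>j<n. c i * c j * a (i + j))"
    and psd1: "\<And>n c. 0 \<le> (\<Sum>i<n. \<Sum>j<n. c i * c j * a (i + j + 1))"
  shows "stieltjes_moment a"
proof -
  have pos: "0 \<le> moment_functional a p" if "\<And>x. x \<ge> 0 \<Longrightarrow> 0 \<le> poly p x" for p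
    using psd0 psd1 that by (rule moment_functional_nonneg)
  have a0: "0 \<le> a 0" using psd0[where n = 1 and c = "\<lambda>_. 1"] by simp
  show ?thesis
  proof (cases "a 0 = 0")
    case True
    have "a n = 0" for n
    proof -
      \<comment> \<open>The functional applied to \<open>(X^n + t)^2\<close>; since
        \<open>a 0 = 0\<close> the result is affine in \<open>t\<close>, so its slope must
        vanish.\<close>
      have quad: "0 \<le> a (2 * n) + 2 * t * a n" for t
      proof -
        define p where "p = Polynomial.monom 1 (2 * n) + Polynomial.monom (2 * t) n + Polynomial.monom (t * t) 0"
        have "poly p x = (x ^ n + t)\<^sup>2" for x
          by (simp add: p_def poly_monom power2_sum power_even_eq power2_eq_square[of t])
        then have "0 \<le> moment_functional a p" by (intro pos) simp
        then show ?thesis by (simp add: p_def moment_functional_add moment_functional_monom True)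
      qed
      show ?thesis
      proof (rule ccontr)
        assume "a n \<noteq> 0"
        then show False using quad[of "(- 1 - a (2 * n)) / (2 * a n)"] by (simp add: field_simps)
      qed
    qed
    then have "a = (\<lambda>n. 0)" by auto
    then show ?thesis using stieltjes_moment_zero by simp
  next
    case False
    then have a0: "0 < a 0" using a0 by simp
    \<comment> \<open>The bound \<open>a 0\<close> inside the minimum keeps the total mass of each
      approximation positive, so that it can be normalized.\<close>
    define Q where "Q n S w \<longleftrightarrow> finite S \<and> (\<forall>x\<in>S. 0 \<le> x \<and> 0 \<le> w x) \<and>
        (\<forall>i\<le>n. \<bar>a i - (\<Sum>x\<in>S. w x * x ^ i)\<bar> < min (1 / real (Suc n)) (a 0))" for n S and w :: "real \<Rightarrow> real"
    have "\<exists>S w. Q n S w" for n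
    proof -
      have "0 < min (1 / real (Suc n)) (a 0)" using a0 by simp
      with pos have "\<exists>m\<in>atomic_moments. \<forall>i\<le>n. \<bar>a i - m i\<bar> < min (1 / real (Suc n)) (a 0)"
        by (rule atomic_moments_approx)
      then obtain m where "m \<in> atomic_moments" and m: "\<forall>i\<le>n. \<bar>a i - m i\<bar> < min (1 / real (Suc n)) (a 0)"
        by blast
      then obtain S w where "finite S" "\<forall>x\<in>S. 0 \<le> x \<and> 0 \<le> w x" "m = (\<lambda>i. \<Sum>x\<in>S. w x * x ^ i)"
        unfolding atomic_moments_def by blast
      then have "Q n S w" using m by (simp add: Q_def)
      then show ?thesis by blast
    qed
    then obtain S w where Q: "\<And>n. Q n (S n) (w n)" by metis
    have S: "\<And>n. finite (S n)" "\<And>n x. x \<in> S n \<Longrightarrow> 0 \<le> x \<and> 0 \<le> w n x"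
      and approx: "\<And>n i. i \<le> n \<Longrightarrow> \<bar>a i - (\<Sum>x\<in>S n. w n x * x ^ i)\<bar> < min (1 / real (Suc n)) (a 0)"
      using Q unfolding Q_def by blast+
    define m where "m n i = (\<Sum>x\<in>S n. w n x * x ^ i)" for n i
    have m0: "0 < m n 0" for n using approx[of 0 n] by (simp add: m_def) linarith
    have m_lim: "(\<lambda>n. m n i) \<longlonglongrightarrow> a i" for i
    proof (rule LIMSEQ_I)
      fix e :: real assume "0 < e"
      then obtain N where N: "1 / real (Suc N) < e" using nat_approx_posE by blast
      show "\<exists>n0. \<forall>n\<ge>n0. norm (m n i - a i) < e"
      proof (intro exI allI impI)
        fix n assume n: "max N i \<le> n"
        then have "\<bar>a i - m n i\<bar> < 1 / real (Suc n)" using approx[of i n] by (simp add: m_def)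
        also have "\<dots> \<le> 1 / real (Suc N)" using n by (simp add: frac_le)
        finally show "norm (m n i - a i) < e" using N by (simp add: abs_minus_commute)
      qed
    qed
    define v where "v n x = w n x / m n 0" for n x
    have v: "0 \<le> x \<and> 0 \<le> v n x" if "x \<in> S n" for n x
      using S(2)[OF that] m0[of n] by (simp add: v_def)
    have "\<exists>M. real_distribution M \<and> (\<forall>f :: real \<Rightarrow> real. f \<in> borel_measurable borel \<longrightarrow>
        integral\<^sup>L M f = (\<Sum>x\<in>S n. v n x * f x))" for n
    proof -
      have "(\<Sum>x\<in>S n. v n x) = 1"
        using m0[of n] by (simp add: v_def m_def flip: sum_divide_distrib)
      then show ?thesis using atomic_distribution[of "S n" "v n"] S(1) v by metis
    qed
    then obtain \<mu> where \<mu>: "\<And>n. real_distribution (\<mu> n)"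
      "\<And>n (f :: real \<Rightarrow> real). f \<in> borel_measurable borel \<Longrightarrow> integral\<^sup>L (\<mu> n) f = (\<Sum>x\<in>S n. v n x * f x)"
      by metis
    have lim: "(\<lambda>n. \<Sum>x\<in>S n. v n x * x ^ k) \<longlonglongrightarrow> a k / a 0" for k
    proof -
      have "(\<Sum>x\<in>S n. v n x * x ^ k) = m n k / m n 0" for n
        by (simp add: v_def m_def sum_divide_distrib)
      then show ?thesis using tendsto_divide[OF m_lim[of k] m_lim[of 0]] a0 by simp
    qed
    obtain M where M: "real_distribution M" "AE x in M. 0 \<le> x"
      "\<And>k. integrable M (\<lambda>x. max 0 x ^ k)" "\<And>k. integral\<^sup>L M (\<lambda>x. max 0 x ^ k) = a k / a 0"
      by (rule weak_limit_moments[OF \<mu>(1) S(1) v \<mu>(2) lim]) blast+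
    interpret M: real_distribution M by (rule M)
    define \<nu> where "\<nu> = density M (\<lambda>_. ennreal (a 0))"
    have AE: "AE x in M. a 0 *\<^sub>R (indicat_real {0..} x *\<^sub>R x ^ n) = a 0 * max 0 x ^ n" for n
      using M(2) by eventually_elim (simp add: max_def)
    have "set_integrable \<nu> {0..} (\<lambda>x. x ^ n)" for n
    proof -
      have "integrable M (\<lambda>x. a 0 *\<^sub>R (indicat_real {0..} x *\<^sub>R x ^ n))"
        using M(3)[of n] by (subst integrable_cong_AE[OF _ _ AE]) auto
      then show ?thesis
        unfolding set_integrable_def \<nu>_def using a0 by (subst integrable_density) auto
    qed
    moreover have "a n = (LINT x:{0..}|\<nu>. x ^ n)" for n
    proof -
      have "(LINT x:{0..}|\<nu>. x ^ n) = (LINT x|M. a 0 *\<^sub>R (indicat_real {0..} x *\<^sub>R x ^ n))"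
        unfolding set_lebesgue_integral_def \<nu>_def using a0 by (subst integral_density) auto
      also have "\<dots> = (LINT x|M. a 0 * max 0 x ^ n)"
        by (rule integral_cong_AE[OF _ _ AE]) auto
      also have "\<dots> = a n" using M(4)[of n] a0 by simp
      finally show ?thesis by simp
    qed
    moreover have "sets \<nu> = sets borel" by (simp add: \<nu>_def)
    ultimately show ?thesis unfolding stieltjes_moment_def by blast
  qed
qed

text \<open>A nonnegative combination of powers has a nonnegative integral. The free index set and
  exponents allow it to be used for both sequences on the same sum over triples.\<close>

lemma stieltjes_moment_nonneg:
  assumes "stieltjes_moment s" "finite I" "\<And>x. 0 \<le> x \<Longrightarrow> 0 \<le> (\<Sum>i\<in>I. e i * x ^ d i)"
  shows "0 \<le> (\<Sum>i\<in>I. e i * s (d i))"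
proof -
  obtain \<mu> where \<mu>: "\<And>n. set_integrable \<mu> {0..} (\<lambda>x::real. x ^ n)"
      "\<And>n. s n = set_lebesgue_integral \<mu> {0..} (\<lambda>x. x ^ n)"
    using assms(1) by (auto simp: stieltjes_moment_def)
  have int: "integrable \<mu> (\<lambda>x. e i * (indicator {0..} x *\<^sub>R x ^ d i))" for i
    using \<mu>(1)[of "d i"] unfolding set_integrable_def by (rule integrable_mult_right)
  have "(\<Sum>i\<in>I. e i * s (d i)) = (LINT x|\<mu>. (\<Sum>i\<in>I. e i * (indicator {0..} x *\<^sub>R x ^ d i)))"
    unfolding \<mu>(2) set_lebesgue_integral_def using int by simp
  also have "\<dots> \<ge> 0"
  proof (rule integral_nonneg_AE, rule AE_I2)
    fix x
    show "0 \<le> (\<Sum>i\<in>I. e i * (indicator {0..} x *\<^sub>R x ^ d i))"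
      using assms(3)[of x] by (cases "0 \<le> x") auto
  qed
  finally show ?thesis .
qed

section \<open>Evaluation and convolution\<close>

context
  fixes \<rho> :: "'v \<Rightarrow> real"
begin

definition monomial_value :: "('v \<Rightarrow>\<^sub>0 nat) \<Rightarrow> real" where
  "monomial_value e = (\<Prod>v \<in> Poly_Mapping.keys e. \<rho> v ^ Poly_Mapping.lookup e v)"

lemma monomial_value_add: "monomial_value (e + e') = monomial_value e * monomial_value e'"
proof -
  let ?K = "Poly_Mapping.keys e \<union> Poly_Mapping.keys e'"
  have eq: "monomial_value f = (\<Prod>v\<in>?K. \<rho> v ^ Poly_Mapping.lookup f v)"
    if "Poly_Mapping.keys f \<subseteq> ?K" for f
    unfolding monomial_value_def using that
    by (intro prod.mono_neutral_left) (auto simp: in_keys_iff)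
  show ?thesis
    using eq[OF keys_add] eq[of e] eq[of e'] by (simp add: lookup_add power_add prod.distrib)
qed

lemma meval_superset:
  assumes "finite K" "Poly_Mapping.keys p \<subseteq> K"
  shows "meval \<rho> p = (\<Sum>e\<in>K. Poly_Mapping.lookup p e * monomial_value e)"
  unfolding meval_def monomial_value_def using assms
  by (intro sum.mono_neutral_left) (auto simp: in_keys_iff)

lemma meval_add: "meval \<rho> (p + r) = meval \<rho> p + meval \<rho> r"
proof -
  let ?K = "Poly_Mapping.keys p \<union> Poly_Mapping.keys r"
  show ?thesis
    using meval_superset[of ?K p] meval_superset[of ?K r] meval_superset[of ?K "p + r", OF _ keys_add]
    by (simp add: lookup_add distrib_right sum.distrib)
qed

lemma meval_zero: "meval \<rho> 0 = 0"
  by (simp add: meval_def)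

lemma meval_sum: "meval \<rho> (sum f I) = (\<Sum>i\<in>I. meval \<rho> (f i))"
  by (induction I rule: infinite_finite_induct) (simp_all add: meval_add meval_zero)

lemma meval_single: "meval \<rho> (Poly_Mapping.single e c) = c * monomial_value e"
  using meval_superset[of "{e}" "Poly_Mapping.single e c"] by simp

lemma meval_mult: "meval \<rho> (p * r) = meval \<rho> p * meval \<rho> r"
proof -
  have expand: "meval \<rho> p = (\<Sum>e\<in>Poly_Mapping.keys p. Poly_Mapping.lookup p e * monomial_value e)" for p
    by (rule meval_superset) auto
  have "meval \<rho> (p * r) = meval \<rho> ((\<Sum>e\<in>Poly_Mapping.keys p. Poly_Mapping.single e (Poly_Mapping.lookup p e)) *
      (\<Sum>e\<in>Poly_Mapping.keys r. Poly_Mapping.single e (Poly_Mapping.lookup r e)))"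
    by (simp flip: mpoly_eq_sum_single)
  also have "\<dots> = meval \<rho> p * meval \<rho> r"
    unfolding expand[of p] expand[of r] sum_product mult_single meval_sum meval_single monomial_value_add
    by (intro sum.cong refl) (simp add: mult_ac)
  finally show ?thesis .
qed

lemma comm_ring_hom_meval: "comm_ring_hom (meval \<rho>)"
proof
  show "meval \<rho> 0 = 0" by (rule meval_zero)
  show "meval \<rho> 1 = 1"
    using meval_single[of 0 1] by (simp add: monomial_value_def)
qed (simp_all add: meval_add meval_mult)

lemma meval_nonneg: "(\<And>v. 0 \<le> \<rho> v) \<Longrightarrow> mcoeff_nonneg p \<Longrightarrow> 0 \<le> meval \<rho> p"
  by (auto simp: meval_def mcoeff_nonneg_def intro!: sum_nonneg mult_nonneg_nonneg prod_nonneg)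

end

lemma positive_specialization_meval:
  assumes "\<And>v. 0 \<le> \<rho> v" "0 \<le> q"
  shows "positive_specialization {0..} (meval \<rho>) q"
proof -
  interpret comm_ring_hom "meval \<rho>" by (rule comm_ring_hom_meval)
  show ?thesis by unfold_locales (use assms meval_nonneg in auto)
qed

lemma positive_specialization_poly:
  "positive_specialization {p. \<forall>d. mcoeff_nonneg (coeff p d)} (\<lambda>c :: 'v mpoly. [:c:]) [:0, 1:]"
proof
  have one: "mcoeff_nonneg (1 :: 'v mpoly)"
    using mcoeff_nonneg_single[of 1 0] by simp
  show "1 \<in> {p :: 'v mpoly poly. \<forall>d. mcoeff_nonneg (coeff p d)}"
    "[:0, 1:] \<in> {p :: 'v mpoly poly. \<forall>d. mcoeff_nonneg (coeff p d)}"
    using one by (auto simp: coeff_pCons mcoeff_nonneg_zero split: nat.splits)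
  fix p r :: "'v mpoly poly"
  assume "p \<in> {p. \<forall>d. mcoeff_nonneg (coeff p d)}" "r \<in> {p. \<forall>d. mcoeff_nonneg (coeff p d)}"
  then show "p + r \<in> {p. \<forall>d. mcoeff_nonneg (coeff p d)}" "p * r \<in> {p. \<forall>d. mcoeff_nonneg (coeff p d)}"
    by (auto simp: coeff_mult intro!: mcoeff_nonneg_add mcoeff_nonneg_sum mcoeff_nonneg_mult)
qed (auto simp: mcoeff_nonneg_zero coeff_pCons split: nat.splits)

lemma binomial_positive_Pmat:
  fixes N :: "'a::comm_ring_1 set" and hom :: "(param + 'x) mpoly \<Rightarrow> 'a"
  assumes "positive_specialization N hom q"
    and params: "parameter_values \<theta>"
    and pf: "\<And>i. 1 \<le> i \<Longrightarrow> polya_frequency xvars (f i)"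
    and factors: "\<And>M. M \<in> set Ms \<union> set Ns \<Longrightarrow>
      \<exists>i\<ge>1. M = Lmat (\<theta> (Pahat i)) (\<theta> (Pbhat i)) (\<theta> (Pchat i)) \<or> M = Gmat (f i)"
    and prod: "Pmat m \<beta> =
      imat_prod (Ms @ [Jmat (\<theta> Pa) (\<theta> Pb) (\<theta> Pu) (\<theta> Pv) (\<theta> Plam)] @ Ns)"
  shows "positive_specialization.binomial_positive N hom q 1 (Pmat m \<beta>)"
proof -
  interpret positive_specialization N hom q by fact
  have \<theta>: "mcoeff_nonneg (\<theta> p)" for p
    using params by (auto simp: parameter_values_def mcoeff_nonneg_mvar mcoeff_nonneg_mconst)
      (metis mcoeff_nonneg_mvar mcoeff_nonneg_mconst)
  have M: "binomial_positive 0 M" if "M \<in> set Ms \<union> set Ns" for M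
    using factors[OF that] binomial_positive_Lmat[OF \<theta> \<theta> \<theta>] binomial_positive_Gmat[OF pf] by auto
  show ?thesis
    unfolding prod
    by (rule binomial_positive_prod_insert[OF _ binomial_positive_Jmat[OF \<theta> \<theta> \<theta> \<theta> \<theta>]])
      (use M in \<open>auto intro: binomial_positive_prod\<close>)
qed

text \<open>Formally \<open>z n\<close> is the double integral of \<open>y^n J_n(x/y)\<close>. The
  power \<open>y^(i+j)\<close> is absorbed into the coefficients as \<open>c i * y^i\<close> and
  \<open>c j * y^j\<close>, so one positive form at \<open>q = x/y\<close> suffices. The shift
  \<open>e\<close> is 0 or 1 for the two Hankel forms.\<close>

lemma stieltjes_moment_convolution:
  fixes J :: "nat \<Rightarrow> nat \<Rightarrow> real"
  assumes hankel: "\<And>q k r c. 0 \<le> q \<Longrightarrow> strict_mono_on {..<k} r \<Longrightarrow> strict_mono_on {..<k} c \<Longrightarrow>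
      0 \<le> imat_minor (\<lambda>i j. \<Sum>l\<le>i + j. J (i + j) l * q ^ l) k r c"
    and s: "stieltjes_moment s" and t: "stieltjes_moment t"
  shows "stieltjes_moment (\<lambda>n. \<Sum>k\<le>n. J n k * s k * t (n - k))"
proof -
  have psd: "0 \<le> (\<Sum>i<n. \<Sum>j<n. c i * c j * (\<Sum>k\<le>i + j + e. J (i + j + e) k * s k * t (i + j + e - k)))"
    for n e and c :: "nat \<Rightarrow> real"
  proof -
    define h where "h q n = (\<Sum>k\<le>n. J n k * q ^ k)" for q n
    have psd_h: "0 \<le> (\<Sum>i<n. \<Sum>j<n. b i * b j * h q (i + j + e))" if "0 \<le> q" for q and b :: "nat \<Rightarrow> real"
    proof (rule psd_of_principal_minors)
      show "h q (i + j + e) = h q (j + i + e)" for i j by (simp add: add.commute)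
      fix k and r :: "nat \<Rightarrow> nat" assume r: "strict_mono_on {..<k} r"
      \<comment> \<open>A principal minor of the shifted Hankel matrix is in general not a principal
        minor of the original one: its rows are moved by \<open>e\<close>, its columns are not. This
        is where positivity of all minors is used.\<close>
      then have "strict_mono_on {..<k} (\<lambda>i. r i + e)" by (auto simp: strict_mono_on_def)
      from hankel[OF that this r] show "0 \<le> imat_minor (\<lambda>i j. h q (i + j + e)) k r r"
        by (simp add: imat_minor_def h_def add_ac)
    qed
    define I where "I = (SIGMA i:{..<n}. SIGMA j:{..<n}. {..i + j + e})"
    define g where "g = (\<lambda>(i, j, k). c i * c j * J (i + j + e) k)"
    define v where "v = (\<lambda>(i, j, k). i + j + e - k)"
    define du where "du = (\<lambda>(i::nat, j::nat, k::nat). k)"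
    have fin: "finite I" by (auto simp: I_def)
    have sum_I: "(\<Sum>z\<in>I. F z) = (\<Sum>i<n. \<Sum>j<n. \<Sum>k\<le>i + j + e. F (i, j, k))" for F :: "_ \<Rightarrow> real"
      unfolding I_def by (simp add: sum.Sigma split_def)
    have pos: "0 \<le> (\<Sum>z\<in>I. g z * y ^ v z * x ^ du z)" if x: "0 \<le> x" and y: "0 < y" for x y :: real
    proof -
      have "(\<Sum>z\<in>I. g z * y ^ v z * x ^ du z) =
          (\<Sum>i<n. \<Sum>j<n. y ^ e * ((c i * y ^ i) * (c j * y ^ j) * h (x / y) (i + j + e)))"
        unfolding sum_I h_def sum_distrib_left
      proof (intro sum.cong refl)
        fix i j k assume "k \<in> {..i + j + e}"
        then have "y ^ (i + j + e) = y ^ (i + j + e - k) * y ^ k"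
          by (simp flip: power_add)
        then have "y ^ (i + j + e - k) * x ^ k = y ^ e * y ^ i * y ^ j * (x / y) ^ k"
          using y by (simp add: power_add power_divide mult_ac)
        then show "g (i, j, k) * y ^ v (i, j, k) * x ^ du (i, j, k) =
            y ^ e * (c i * y ^ i * (c j * y ^ j) * (J (i + j + e) k * (x / y) ^ k))"
          by (simp add: g_def v_def du_def mult.assoc)
      qed
      also have "\<dots> = y ^ e * (\<Sum>i<n. \<Sum>j<n. (c i * y ^ i) * (c j * y ^ j) * h (x / y) (i + j + e))"
        by (simp add: sum_distrib_left)
      also have "\<dots> \<ge> 0" using psd_h[of "x / y" "\<lambda>i. c i * y ^ i"] x y by simp
      finally show ?thesis .
    qed
    \<comment> \<open>The measure of \<open>t\<close> may charge 0, where \<open>x / y\<close> is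
      meaningless; the value there is a limit of a polynomial in \<open>y\<close>.\<close>
    have pos0: "0 \<le> (\<Sum>z\<in>I. g z * y ^ v z * x ^ du z)" if x: "0 \<le> x" and y: "0 \<le> y" for x y :: real
    proof (cases "y = 0")
      case True
      define p where "p = (\<Sum>z\<in>I. Polynomial.monom (g z * x ^ du z) (v z))"
      have p: "poly p y = (\<Sum>z\<in>I. g z * y ^ v z * x ^ du z)" for y
        by (simp add: p_def poly_sum poly_monom mult_ac)
      have "0 \<le> poly p 0" by (rule poly_nonneg_right) (unfold p, rule pos[OF x])
      then show ?thesis unfolding p True .
    qed (use pos x y in auto)
    \<comment> \<open>Integration over \<open>x\<close> for fixed \<open>y\<close> turns the powers
      of \<open>x\<close> into moments \<open>s\<close>; the next line integrates over
      \<open>y\<close>.\<close>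
    have "0 \<le> (\<Sum>z\<in>I. g z * s (du z) * y ^ v z)" if y: "0 \<le> y" for y
      using stieltjes_moment_nonneg[OF s fin, of "\<lambda>z. g z * y ^ v z" du] pos0[OF _ y]
      by (simp add: mult_ac)
    from stieltjes_moment_nonneg[OF t fin this] show ?thesis
      unfolding sum_I by (simp add: g_def v_def du_def sum_distrib_left mult.assoc)
  qed
  show ?thesis
    by (rule stieltjes_moment_if_psd) (use psd[where e = 0] psd[where e = 1] in simp_all)
qed

theorem theorem1p14:
  fixes m :: enat
    and \<beta> :: "int \<Rightarrow> nat \<Rightarrow> (param + 'x) mpoly"
    and \<theta> :: "param \<Rightarrow> (param + 'x) mpoly"
    and f :: "nat \<Rightarrow> (param + 'x) mpoly fps"
    and Ms Ns :: "(param + 'x) mpoly imat list"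
  assumes m: "1 \<le> m"
    and params: "parameter_values \<theta>"
    and pf: "\<And>i. 1 \<le> i \<Longrightarrow> polya_frequency xvars (f i)"
    and factors: "\<And>M. M \<in> set Ms \<union> set Ns \<Longrightarrow>
      \<exists>i\<ge>1. M = Lmat (\<theta> (Pahat i)) (\<theta> (Pbhat i)) (\<theta> (Pchat i)) \<or> M = Gmat (f i)"
    and prod: "Pmat m \<beta> =
      imat_prod (Ms @ [Jmat (\<theta> Pa) (\<theta> Pb) (\<theta> Pu) (\<theta> Pv) (\<theta> Plam)] @ Ns)"
  shows "log_convex_order 3 (jacobi_rogers_row m \<beta>) \<and>
    (\<forall>\<rho>. (\<forall>w. 0 \<le> \<rho> w) \<longrightarrow>
      (\<forall>s t. stieltjes_moment s \<longrightarrow> stieltjes_moment t \<longrightarrow>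
        stieltjes_moment (\<lambda>n. \<Sum>k\<le>n. meval \<rho> (jacobi_rogers m \<beta> n k) * s k * t (n - k))))"
proof (intro conjI allI impI)
  let ?N = "{p :: (param + 'x) mpoly poly. \<forall>d. mcoeff_nonneg (coeff p d)}"
  interpret positive_specialization ?N "\<lambda>c :: (param + 'x) mpoly. [:c:]" "[:0, 1:]"
    by (rule positive_specialization_poly)
  have "binomial_positive 1 (Pmat m \<beta>)"
    using positive_specialization_axioms params pf factors prod by (rule binomial_positive_Pmat)
  then have "tot_pos (\<lambda>i j. \<Sum>k\<le>i + j. [:jacobi_rogers m \<beta> (i + j) k:] * [:0, 1:] ^ k)"
    by (rule jacobi_rogers_hankel)
  then have "tot_pos (\<lambda>i j. jacobi_rogers_row m \<beta> (i + j))"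
    by (simp add: jacobi_rogers_row_def monom_altdef)
  then show "log_convex_order 3 (jacobi_rogers_row m \<beta>)"
    unfolding log_convex_order_def using Lop_funpow_mem by blast
next
  fix \<rho> :: "param + 'x \<Rightarrow> real" and s t
  assume \<rho>: "\<forall>w. 0 \<le> \<rho> w" and s: "stieltjes_moment s" and t: "stieltjes_moment t"
  show "stieltjes_moment (\<lambda>n. \<Sum>k\<le>n. meval \<rho> (jacobi_rogers m \<beta> n k) * s k * t (n - k))"
  proof (rule stieltjes_moment_convolution[OF _ s t])
    fix q :: real and k :: nat and r c :: "nat \<Rightarrow> nat"
    assume q: "0 \<le> q" and rc: "strict_mono_on {..<k} r" "strict_mono_on {..<k} c"
    have spec: "positive_specialization {0..} (meval \<rho>) q"
      using \<rho> q by (intro positive_specialization_meval) auto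
    interpret positive_specialization "{0..}" "meval \<rho>" q by (rule spec)
    have "binomial_positive 1 (Pmat m \<beta>)"
      using spec params pf factors prod by (rule binomial_positive_Pmat)
    from tot_posD[OF jacobi_rogers_hankel[OF this] rc]
    show "0 \<le> imat_minor (\<lambda>i j. \<Sum>l\<le>i + j. meval \<rho> (jacobi_rogers m \<beta> (i + j) l) * q ^ l) k r c"
      by simp
  qed
qed

end
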